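(* Let $H$ be a Lie group with Lie algebra $\mathfrak h$, let $L:\mathrm{T}H\approx H\times\mathfrak h\to\mathbb R$ be a smooth Lagrangian, let $d\subset\mathfrak h$ be a linear subspace defining the left-invariant constraints distribution $D=H\times d\subset \mathrm{T}H$, and let $\mathfrak h=d\oplus d'$ be a splitting into linear subspaces with projections $P:\mathfrak h\to d$, $P':\mathfrak h\to d'$. An admissible curve $(h(t),\eta(t))\in H\times d$ is: (i) a nonholonomic extremal if and only if for every $t\in[t_0,t_1]$ $$h(t)^*\Big(\frac{\partial L}{\partial h}\Big)-\frac{\mathrm d}{\mathrm dt}\Big(\frac{\partial L}{\partial\eta}\Big)+\operatorname{ad}^*_{\eta(t)}\Big(\frac{\partial L}{\partial \eta}\Big)\in\operatorname{Ann}(d)\subset\mathfrak h^*;$$ (ii) a vakonomic extremal associated with a modified Lagrangian $\widetilde L(h,\eta,t)=L(h,\eta)-\langle\lambda(t),P'(\eta)\rangle$ (where $\lambda(t)\in(d')^*\approx\operatorname{Ann}(d)\subset\mathfrak h^*$) if and only if $$\Big\langle h(t)^*\Big(\frac{\partial L}{\partial h}\Big)-\frac{\mathrm d}{\mathrm dt}\Big(\frac{\partial L}{\partial\eta}\Big)+\operatorname{ad}^*_{\eta(t)}\Big(\frac{\partial L}{\partial \eta}-\lambda(t)\Big),a\Big\rangle=0$$ for every $t\in[t_0,t_1]$ and every $a\in d$, and $$\Big\langle h(t)^*\Big(\frac{\partial L}{\partial h}\Big)-\frac{\mathrm d}{\mathrm dt}\Big(\frac{\partial L}{\partial\eta}-\lambda(t)\Big)+\operatorname{ad}^*_{\eta(t)}\Big(\frac{\partial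 L}{\partial \eta}-\lambda(t)\Big),b\Big\rangle=0$$ for every $t\in[t_0,t_1]$ and every $b\in d'\subset\mathfrak h$.
   Context: Everything is $C^\infty$; $I=[t_0,t_1]$ is a fixed interval. Variations. For a manifold $Q$, $\kappa_Q:\mathrm{TT}Q\to\mathrm{TT}Q$ is the canonical flip, $(q^a,\dot q^b,q'^c,\dot q'^d)\mapsto(q^a,q'^b,\dot q^c,\dot q'^d)$ in induced coordinates. If $\gamma(t)\in\mathrm TQ$ is the tangent lift of a curve $q(t)$ (an admissible path) and $\xi(t)\in\mathrm T_{q(t)}Q$ is a curve (generator), the admissible variation generated by $\xi$ is $\delta_\xi\gamma(t)=\kappa_Q(\mathrm T_t\xi(t))\in\mathrm T_{\gamma(t)}\mathrm TQ$, where $\mathrm T_t\xi(t)$ is the tangent lift of the curve $\xi$; and $\langle\mathrm dS_L(\gamma),\delta\gamma\rangle=\int_I\langle\mathrm dL(\gamma(t)),\delta\gamma(t)\rangle\mathrm dt$ (for a time-dependent Lagrangian, differentiate in the $\mathrm TQ$ variable). Lie group setting ($Q=H$). $\mathfrak h=\mathrm T_eH$ with the left Lie bracket $[\cdot,\cdot]_{\mathfrak h}$; $\mathrm TH\approx H\times\mathfrak h$ via $(h,\eta)\mapsto h_*\eta$ (left translation). A curve $(h(t),\eta(t))$ is admissible if $h(t)_*\eta(t)$ is the tangent lift of $h(t)$; generators are written as $\xi(t)\in\mathfrak h$ (standing for $h(t)_*\xi(t)$). An admissible curve with $\eta(t)\in d$ is a nonholonomic extremal if $\langle\mathrm dS_L,\delta_\xi\eta\rangle=0$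 for all generators $\xi(t)\in d$ with $\xi(t_0)=\xi(t_1)=0$; it is a vakonomic extremal associated with the modified Lagrangian $\widetilde L$ if it is an unconstrained extremal of $\widetilde L$, i.e. $\langle\mathrm dS_{\widetilde L},\delta_\xi\eta\rangle=0$ for all generators $\xi(t)\in\mathfrak h$ with $\xi(t_0)=\xi(t_1)=0$. Notation. $\frac{\partial L}{\partial h}\in\mathrm T_h^*H$ and $\frac{\partial L}{\partial\eta}\in\mathfrak h^*$ are the partial differentials of $L(h,\eta)$, evaluated at $(h(t),\eta(t))$; $\langle h^*\phi,\xi\rangle=\langle\phi,h_*\xi\rangle$ for $\phi\in\mathrm T^*_hH$, $\xi\in\mathfrak h$; $\langle\operatorname{ad}^*_\eta\phi,\cdot\rangle=\langle\phi,[\eta,\cdot]_{\mathfrak h}\rangle$ for $\phi\in\mathfrak h^*$; $\operatorname{Ann}(d)\subset\mathfrak h^*$ is the annihilator of $d$, identified with $(d')^*$ via $\lambda=(P')^*\lambda$. *)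

theory Defs
  imports "HOL-Analysis.Analysis" "HOL-Algebra.Group"
begin

section \<open>Smooth maps between normed spaces\<close>

text \<open>Used only on open subsets of Euclidean spaces and on relatively open subsets of a
  nondegenerate interval (with one-sided derivatives at its end points); there the derivative
  \<open>f'\<close> is unique, and, the domain being finite-dimensional, the directional formulation of the
  recursion is ordinary \<open>C\<^sup>k\<close> regularity.\<close>

primrec Ck_on :: "nat \<Rightarrow> 'a::real_normed_vector set \<Rightarrow> ('a \<Rightarrow> 'b::real_normed_vector) \<Rightarrow> bool" where
  "Ck_on 0 S f \<longleftrightarrow> continuous_on S f"
| "Ck_on (Suc k) S f \<longleftrightarrow>
     (\<exists>f'. (\<forall>x\<in>S. (f has_derivative f' x) (at x within S)) \<and> (\<forall>v. Ck_on k S (\<lambda>x. f' x v)))"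

definition smooth_on :: "'a::real_normed_vector set \<Rightarrow> ('a \<Rightarrow> 'b::real_normed_vector) \<Rightarrow> bool" where
  "smooth_on S f \<longleftrightarrow> (\<forall>k. Ck_on k S f)"


section \<open>Manifolds\<close>

text \<open>A chart is a pair of its domain and its coordinate map (whose values off the domain are
  irrelevant). The manifold is the union of the chart domains, its topology is the one induced
  by the atlas.\<close>

type_synonym ('m, 'e) chart = "'m set \<times> ('m \<Rightarrow> 'e)"

abbreviation cdom :: "('m, 'e) chart \<Rightarrow> 'm set" where "cdom c \<equiv> fst c"
abbreviation coords :: "('m, 'e) chart \<Rightarrow> 'm \<Rightarrow> 'e" where "coords c \<equiv> snd c"

definition cinv :: "('m, 'e) chart \<Rightarrow> 'e \<Rightarrow> 'm" where
  "cinv c = inv_into (cdom c) (coords c)"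

definition points :: "('m, 'e) chart set \<Rightarrow> 'm set" where
  "points A = (\<Union>c\<in>A. cdom c)"

definition manifold_topology :: "('m, 'e::euclidean_space) chart set \<Rightarrow> 'm topology" where
  "manifold_topology A =
     topology_generated_by {{p \<in> cdom c. coords c p \<in> V} | c V. c \<in> A \<and> open V}"

definition smooth_manifold :: "('m, 'e::euclidean_space) chart set \<Rightarrow> bool" where
  "smooth_manifold A \<longleftrightarrow>
     (\<forall>c\<in>A. inj_on (coords c) (cdom c) \<and> open (coords c ` cdom c)) \<and>
     (\<forall>c\<in>A. \<forall>c'\<in>A. open (coords c ` (cdom c \<inter> cdom c')) \<and>
        smooth_on (coords c ` (cdom c \<inter> cdom c')) (coords c' \<circ> cinv c)) \<and>
     Hausdorff_space (manifold_topology A) \<and> second_countable (manifold_topology A)"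

definition euclidean_atlas :: "('e, 'e) chart set" where
  "euclidean_atlas = {(UNIV, \<lambda>x. x)}"

definition product_atlas ::
    "('m, 'e) chart set \<Rightarrow> ('n, 'f) chart set \<Rightarrow> ('m \<times> 'n, 'e \<times> 'f) chart set" where
  "product_atlas A B =
     (\<lambda>(c, c'). (cdom c \<times> cdom c', map_prod (coords c) (coords c'))) ` (A \<times> B)"

definition smooth_map :: "('m, 'e::euclidean_space) chart set \<Rightarrow> ('n, 'f::euclidean_space) chart set
    \<Rightarrow> ('m \<Rightarrow> 'n) \<Rightarrow> bool" where
  "smooth_map A B F \<longleftrightarrow>
     (\<forall>p\<in>points A. \<exists>c\<in>A. \<exists>c'\<in>B. \<exists>W. p \<in> cdom c \<and> open W \<and> coords c p \<in> W \<and>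
        W \<subseteq> coords c ` cdom c \<and> (F \<circ> cinv c) ` W \<subseteq> cdom c' \<and>
        smooth_on W (coords c' \<circ> F \<circ> cinv c))"

definition smooth_curve :: "('m, 'e::euclidean_space) chart set \<Rightarrow> real set \<Rightarrow> (real \<Rightarrow> 'm) \<Rightarrow> bool" where
  "smooth_curve A I q \<longleftrightarrow>
     (\<forall>t\<in>I. \<exists>c\<in>A. \<exists>J. open J \<and> t \<in> J \<and> q ` (I \<inter> J) \<subseteq> cdom c \<and> smooth_on (I \<inter> J) (coords c \<circ> q))"


section \<open>Tangent bundles\<close>

text \<open>Each point is assigned one chart around it, and a tangent vector at \<open>p\<close> is represented by
  its components in the chart assigned to \<open>p\<close>. Thus every tangent space is the model space as a
  vector space, and \<open>TM\<close> consists of the pairs \<open>(p, v)\<close>; its manifold structure is given by the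
  induced charts \<open>(q, q\<^sup>.)\<close>, i.e. by \<open>tangent_atlas\<close>, and not by the product structure. Iterating
  the construction gives \<open>TTM\<close>.\<close>

definition chart_at :: "('m, 'e) chart set \<Rightarrow> 'm \<Rightarrow> ('m, 'e) chart" where
  "chart_at A p = (SOME c. c \<in> A \<and> p \<in> cdom c)"

definition tangent_chart :: "('m, 'e::euclidean_space) chart set \<Rightarrow> ('m, 'e) chart
    \<Rightarrow> ('m \<times> 'e, 'e \<times> 'e) chart" where
  "tangent_chart A c =
     (cdom c \<times> UNIV,
      \<lambda>(p, v). (coords c p,
        frechet_derivative (coords c \<circ> cinv (chart_at A p)) (at (coords (chart_at A p) p)) v))"

definition tangent_atlas ::
    "('m, 'e::euclidean_space) chart set \<Rightarrow> ('m \<times> 'e, 'e \<times> 'e) chart set" where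
  "tangent_atlas A = tangent_chart A ` A"

definition tangent_map :: "('m, 'e::euclidean_space) chart set \<Rightarrow> ('n, 'f::euclidean_space) chart set
    \<Rightarrow> ('m \<Rightarrow> 'n) \<Rightarrow> 'm \<times> 'e \<Rightarrow> 'n \<times> 'f" where
  "tangent_map A B F = (\<lambda>(p, v). (F p,
     frechet_derivative (coords (chart_at B (F p)) \<circ> F \<circ> cinv (chart_at A p))
       (at (coords (chart_at A p) p)) v))"

definition differential ::
    "('m, 'e::euclidean_space) chart set \<Rightarrow> ('m \<Rightarrow> real) \<Rightarrow> 'm \<Rightarrow> 'e \<Rightarrow> real" where
  "differential A f p v =
     frechet_derivative (f \<circ> cinv (chart_at A p)) (at (coords (chart_at A p) p)) v"

definition tangent_lift ::
    "('m, 'e::euclidean_space) chart set \<Rightarrow> real set \<Rightarrow> (real \<Rightarrow> 'm) \<Rightarrow> real \<Rightarrow> 'm \<times> 'e" where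
  "tangent_lift A I q t =
     (q t, vector_derivative (coords (chart_at A (q t)) \<circ> q) (at t within I))"

text \<open>The flip is computed in the chart of \<open>TTM\<close> induced by the chart assigned to the base point;
  the result does not depend on the chart of \<open>M\<close> around that point.\<close>

definition canonical_flip :: "('m, 'e::euclidean_space) chart set
    \<Rightarrow> ('m \<times> 'e) \<times> ('e \<times> 'e) \<Rightarrow> ('m \<times> 'e) \<times> ('e \<times> 'e)" where
  "canonical_flip A w =
     (let C = tangent_chart (tangent_atlas A) (tangent_chart A (chart_at A (fst (fst w))))
      in case coords C w of ((q, qdot), (q', qdot')) \<Rightarrow> cinv C ((q, q'), (qdot, qdot')))"

definition vf_coords :: "('m, 'e::euclidean_space) chart set \<Rightarrow> ('m, 'e) chart \<Rightarrow> ('m \<Rightarrow> 'e) \<Rightarrow> 'e \<Rightarrow> 'e" where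
  "vf_coords A c X x = snd (coords (tangent_chart A c) (cinv c x, X (cinv c x)))"

definition vf_bracket ::
    "('m, 'e::euclidean_space) chart set \<Rightarrow> ('m \<Rightarrow> 'e) \<Rightarrow> ('m \<Rightarrow> 'e) \<Rightarrow> 'm \<Rightarrow> 'e" where
  "vf_bracket A X Y p =
     (let c = chart_at A p; x = coords c p; X' = vf_coords A c X; Y' = vf_coords A c Y
      in frechet_derivative Y' (at x) (X' x) - frechet_derivative X' (at x) (Y' x))"


section \<open>Variations and action\<close>

definition variation :: "('m, 'e::euclidean_space) chart set \<Rightarrow> real \<Rightarrow> real
    \<Rightarrow> (real \<Rightarrow> 'm \<times> 'e) \<Rightarrow> real \<Rightarrow> ('m \<times> 'e) \<times> ('e \<times> 'e)" where
  "variation A t0 t1 \<zeta> t = canonical_flip A (tangent_lift (tangent_atlas A) {t0..t1} \<zeta> t)"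

definition action_differential :: "('m, 'e::euclidean_space) chart set \<Rightarrow> real \<Rightarrow> real
    \<Rightarrow> (real \<Rightarrow> 'm \<times> 'e \<Rightarrow> real) \<Rightarrow> (real \<Rightarrow> 'm \<times> 'e)
    \<Rightarrow> (real \<Rightarrow> ('m \<times> 'e) \<times> ('e \<times> 'e)) \<Rightarrow> real" where
  "action_differential A t0 t1 L \<gamma> \<delta>\<gamma> =
     integral {t0..t1} (\<lambda>t. differential (tangent_atlas A) (L t) (\<gamma> t) (snd (\<delta>\<gamma> t)))"


section \<open>Lie groups\<close>

record ('h, 'e) lie_structure = "'h monoid" +
  atlas :: "('h, 'e) chart set"

definition lie_group :: "('h, 'e::euclidean_space) lie_structure \<Rightarrow> bool" where
  "lie_group G \<longleftrightarrow>
     group G \<and> smooth_manifold (atlas G) \<and> points (atlas G) = carrier G \<and>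
     smooth_map (product_atlas (atlas G) (atlas G)) (atlas G) (\<lambda>(x, y). x \<otimes>\<^bsub>G\<^esub> y) \<and>
     smooth_map (atlas G) (atlas G) (\<lambda>x. inv\<^bsub>G\<^esub> x)"

text \<open>The Lie algebra is the tangent space at \<open>\<one>\<^bsub>G\<^esub>\<close>, hence the model space \<open>'e\<close> with the
  bracket below.\<close>

definition push :: "('h, 'e::euclidean_space) lie_structure \<Rightarrow> 'h \<Rightarrow> 'e \<Rightarrow> 'e" where
  "push G h \<eta> = snd (tangent_map (atlas G) (atlas G) (\<lambda>x. h \<otimes>\<^bsub>G\<^esub> x) (\<one>\<^bsub>G\<^esub>, \<eta>))"

definition left_triv :: "('h, 'e::euclidean_space) lie_structure \<Rightarrow> 'h \<times> 'e \<Rightarrow> 'h \<times> 'e" where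
  "left_triv G = (\<lambda>(h, \<eta>). (h, push G h \<eta>))"

definition left_triv_inv :: "('h, 'e::euclidean_space) lie_structure \<Rightarrow> 'h \<times> 'e \<Rightarrow> 'h \<times> 'e" where
  "left_triv_inv G = inv_into (carrier G \<times> UNIV) (left_triv G)"

definition left_bracket :: "('h, 'e::euclidean_space) lie_structure \<Rightarrow> 'e \<Rightarrow> 'e \<Rightarrow> 'e" where
  "left_bracket G a b = vf_bracket (atlas G) (\<lambda>h. push G h a) (\<lambda>h. push G h b) \<one>\<^bsub>G\<^esub>"

text \<open>Covectors are bounded linear functionals on the model space; the arguments of \<open>Blinfun\<close>
  below are linear for smooth \<open>L\<close>. The Lagrangian \<open>L\<close> is a function on \<open>TH\<close>, and its partial
  differentials are those of \<open>(h, \<eta>) \<mapsto> L (h\<^sub>* \<eta>)\<close>.\<close>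

definition pdiff_h :: "('h, 'e::euclidean_space) lie_structure \<Rightarrow> ('h \<times> 'e \<Rightarrow> real)
    \<Rightarrow> 'h \<Rightarrow> 'e \<Rightarrow> 'e \<Rightarrow>\<^sub>L real" where
  "pdiff_h G L h \<eta> = Blinfun (differential (atlas G) (\<lambda>g. L (left_triv G (g, \<eta>))) h)"

definition pdiff_\<eta> :: "('h, 'e::euclidean_space) lie_structure \<Rightarrow> ('h \<times> 'e \<Rightarrow> real)
    \<Rightarrow> 'h \<Rightarrow> 'e \<Rightarrow> 'e \<Rightarrow>\<^sub>L real" where
  "pdiff_\<eta> G L h \<eta> = Blinfun (frechet_derivative (\<lambda>\<theta>. L (left_triv G (h, \<theta>))) (at \<eta>))"

definition pull :: "('h, 'e::euclidean_space) lie_structure \<Rightarrow> 'h \<Rightarrow> 'e \<Rightarrow>\<^sub>L real \<Rightarrow> 'e \<Rightarrow>\<^sub>L real" where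
  "pull G h \<phi> = Blinfun (\<lambda>\<xi>. blinfun_apply \<phi> (push G h \<xi>))"

definition ad_star :: "('h, 'e::euclidean_space) lie_structure \<Rightarrow> 'e \<Rightarrow> 'e \<Rightarrow>\<^sub>L real \<Rightarrow> 'e \<Rightarrow>\<^sub>L real" where
  "ad_star G \<eta> \<phi> = Blinfun (\<lambda>\<xi>. blinfun_apply \<phi> (left_bracket G \<eta> \<xi>))"

definition Ann :: "'e::euclidean_space set \<Rightarrow> ('e \<Rightarrow>\<^sub>L real) set" where
  "Ann d = {\<phi>. \<forall>a\<in>d. blinfun_apply \<phi> a = 0}"

definition splitting :: "'e::euclidean_space set \<Rightarrow> 'e set \<Rightarrow> ('e \<Rightarrow> 'e) \<Rightarrow> ('e \<Rightarrow> 'e) \<Rightarrow> bool" where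
  "splitting d d' P P' \<longleftrightarrow>
     subspace d \<and> subspace d' \<and> d \<inter> d' = {0} \<and>
     (\<forall>\<eta>. P \<eta> \<in> d \<and> P' \<eta> \<in> d' \<and> \<eta> = P \<eta> + P' \<eta>)"


section \<open>Extremals\<close>

definition admissible :: "('h, 'e::euclidean_space) lie_structure \<Rightarrow> real \<Rightarrow> real
    \<Rightarrow> (real \<Rightarrow> 'h) \<Rightarrow> (real \<Rightarrow> 'e) \<Rightarrow> bool" where
  "admissible G t0 t1 h \<eta> \<longleftrightarrow>
     smooth_curve (atlas G) {t0..t1} h \<and> smooth_on {t0..t1} \<eta> \<and>
     (\<forall>t\<in>{t0..t1}. left_triv G (h t, \<eta> t) = tangent_lift (atlas G) {t0..t1} h t)"

text \<open>The pairing of the differential of the action of a (time-dependent) Lagrangian on \<open>TH\<close> with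
  the variation generated by \<open>\<xi>\<close>, which stands for \<open>t \<mapsto> h(t)\<^sub>* \<xi>(t)\<close>.\<close>

definition action_variation :: "('h, 'e::euclidean_space) lie_structure \<Rightarrow> real \<Rightarrow> real
    \<Rightarrow> (real \<Rightarrow> 'h \<times> 'e \<Rightarrow> real) \<Rightarrow> (real \<Rightarrow> 'h) \<Rightarrow> (real \<Rightarrow> 'e) \<Rightarrow> (real \<Rightarrow> 'e) \<Rightarrow> real" where
  "action_variation G t0 t1 L h \<eta> \<xi> =
     action_differential (atlas G) t0 t1 L (\<lambda>t. left_triv G (h t, \<eta> t))
       (variation (atlas G) t0 t1 (\<lambda>t. left_triv G (h t, \<xi> t)))"

definition nonholonomic_extremal :: "('h, 'e::euclidean_space) lie_structure \<Rightarrow> real \<Rightarrow> real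
    \<Rightarrow> ('h \<times> 'e \<Rightarrow> real) \<Rightarrow> 'e set \<Rightarrow> (real \<Rightarrow> 'h) \<Rightarrow> (real \<Rightarrow> 'e) \<Rightarrow> bool" where
  "nonholonomic_extremal G t0 t1 L d h \<eta> \<longleftrightarrow>
     admissible G t0 t1 h \<eta> \<and> (\<forall>t\<in>{t0..t1}. \<eta> t \<in> d) \<and>
     (\<forall>\<xi>. smooth_on {t0..t1} \<xi> \<and> (\<forall>t\<in>{t0..t1}. \<xi> t \<in> d) \<and> \<xi> t0 = 0 \<and> \<xi> t1 = 0 \<longrightarrow>
        action_variation G t0 t1 (\<lambda>t. L) h \<eta> \<xi> = 0)"

definition unconstrained_extremal :: "('h, 'e::euclidean_space) lie_structure \<Rightarrow> real \<Rightarrow> real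
    \<Rightarrow> (real \<Rightarrow> 'h \<times> 'e \<Rightarrow> real) \<Rightarrow> (real \<Rightarrow> 'h) \<Rightarrow> (real \<Rightarrow> 'e) \<Rightarrow> bool" where
  "unconstrained_extremal G t0 t1 L h \<eta> \<longleftrightarrow>
     admissible G t0 t1 h \<eta> \<and>
     (\<forall>\<xi>. smooth_on {t0..t1} \<xi> \<and> \<xi> t0 = 0 \<and> \<xi> t1 = 0 \<longrightarrow>
        action_variation G t0 t1 L h \<eta> \<xi> = 0)"

definition modified_lagrangian :: "('h, 'e::euclidean_space) lie_structure \<Rightarrow> ('h \<times> 'e \<Rightarrow> real)
    \<Rightarrow> ('e \<Rightarrow> 'e) \<Rightarrow> (real \<Rightarrow> 'e \<Rightarrow>\<^sub>L real) \<Rightarrow> real \<Rightarrow> 'h \<times> 'e \<Rightarrow> real" where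
  "modified_lagrangian G L P' lam t =
     (\<lambda>(h, \<eta>). L (left_triv G (h, \<eta>)) - blinfun_apply (lam t) (P' \<eta>)) \<circ> left_triv_inv G"

definition vakonomic_extremal :: "('h, 'e::euclidean_space) lie_structure \<Rightarrow> real \<Rightarrow> real
    \<Rightarrow> (real \<Rightarrow> 'h \<times> 'e \<Rightarrow> real) \<Rightarrow> 'e set \<Rightarrow> (real \<Rightarrow> 'h) \<Rightarrow> (real \<Rightarrow> 'e) \<Rightarrow> bool" where
  "vakonomic_extremal G t0 t1 L d h \<eta> \<longleftrightarrow>
     (\<forall>t\<in>{t0..t1}. \<eta> t \<in> d) \<and> unconstrained_extremal G t0 t1 L h \<eta>"

end

theory Submission
  imports Defs
begin

text \<open>
  The variation of \<open>\<gamma> = h\<^sub>* \<eta>\<close> generated by \<open>h\<^sub>* \<xi>\<close> is computed in a chart of \<open>H\<close>. If \<open>x(t)\<close> are the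
  coordinates of \<open>h(t)\<close> and \<open>M(x)\<close> is the matrix of the left translation at the unit (\<open>frame\<close>), then
  the curve is \<open>(x, x')\<close> with \<open>x' = M(x) \<eta>\<close>, the generator is \<open>y = M(x) \<xi>\<close>, and the canonical flip
  turns its lift into \<open>\<delta>x = y\<close>, \<open>\<delta>x' = y' = DM(x)(x') \<xi> + M(x) \<xi>'\<close> (\<open>variation_coords\<close>).

  Translated back to \<open>H \<times> T\<^sub>eH\<close>, the velocity part must satisfy \<open>\<delta>x' = DM(x)(y) \<eta> + M(x) \<delta>\<eta>\<close>. The columns
  of \<open>M\<close> are left-invariant fields, whose bracket is again left-invariant, so
  \<open>DM(x)(M(x) \<eta>) \<xi> - DM(x)(M(x) \<xi>) \<eta> = M(x) [\<eta>, \<xi>]\<close> (\<open>frame_bracket\<close>), and therefore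
  \<open>\<delta>\<eta> = \<xi>' + [\<eta>, \<xi>]\<close>. The integrand of the first variation becomes
  \<open>\<langle>h\<^sup>*(\<partial>L/\<partial>h) + ad\<^sup>*\<^bsub>\<eta>\<^esub>(\<partial>L/\<partial>\<eta>), \<xi>\<rangle> + \<langle>\<partial>L/\<partial>\<eta>, \<xi>'\<rangle>\<close> (\<open>first_variation_integrand\<close>). Integration by parts
  and the fundamental lemma of the calculus of variations show that it integrates to zero for all
  generators in \<open>d\<close> exactly if \<open>h\<^sup>*(\<partial>L/\<partial>h) - (\<partial>L/\<partial>\<eta>)' + ad\<^sup>*\<^bsub>\<eta>\<^esub>(\<partial>L/\<partial>\<eta>)\<close> annihilates \<open>d\<close>
  (\<open>euler_lagrange_annihilator\<close>). This is the nonholonomic equation.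

  The multiplier \<open>\<lambda>\<close> annihilates \<open>d\<close>, hence \<open>\<langle>\<lambda>, P' \<eta>\<rangle> = \<langle>\<lambda>, \<eta>\<rangle>\<close>, and the modified Lagrangian has the
  same \<open>\<partial>/\<partial>h\<close> as \<open>L\<close> and momentum \<open>\<partial>L/\<partial>\<eta> - \<lambda>\<close>. Its unconstrained equation must hold on \<open>d\<close> and on
  \<open>d'\<close>; on \<open>d\<close> the derivative of \<open>\<lambda>\<close> drops out, which leaves the two vakonomic equations.
\<close>

section \<open>Calculus of \<open>C\<^sup>k\<close> maps\<close>

lemma Ck_on_subset: "Ck_on k S f \<Longrightarrow> T \<subseteq> S \<Longrightarrow> Ck_on k T f"
proof (induction k arbitrary: f)
  case 0
  then show ?case by (auto intro: continuous_on_subset)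
next
  case (Suc k)
  from Suc.prems(1) obtain f' where "\<forall>x\<in>S. (f has_derivative f' x) (at x within S)"
    and "\<forall>v. Ck_on k S (\<lambda>x. f' x v)" by auto
  then have "\<forall>x\<in>T. (f has_derivative f' x) (at x within T)" and "\<forall>v. Ck_on k T (\<lambda>x. f' x v)"
    using Suc.prems(2) Suc.IH by (blast intro: has_derivative_subset)+
  then show ?case by auto
qed

lemma Ck_on_cong: "Ck_on k S f \<Longrightarrow> (\<And>x. x \<in> S \<Longrightarrow> g x = f x) \<Longrightarrow> Ck_on k S g"
proof (induction k arbitrary: f g)
  case 0
  then show ?case by (simp cong: continuous_on_cong)
next
  case (Suc k)
  from Suc.prems(1) obtain f' where "\<forall>x\<in>S. (f has_derivative f' x) (at x within S)"
    and "\<forall>v. Ck_on k S (\<lambda>x. f' x v)" by auto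
  moreover have "\<forall>x\<in>S. (g has_derivative f' x) (at x within S)"
    using calculation Suc.prems(2) has_derivative_transform by blast
  ultimately show ?case by auto
qed

lemma Ck_on_SucI:
  "(\<And>x. x \<in> S \<Longrightarrow> (f has_derivative f' x) (at x within S)) \<Longrightarrow> (\<And>v. Ck_on k S (\<lambda>x. f' x v))
    \<Longrightarrow> Ck_on (Suc k) S f"
  by auto

lemma Ck_on_SucE:
  assumes "Ck_on (Suc k) S f"
  obtains f' where "\<forall>x\<in>S. (f has_derivative f' x) (at x within S)"
    and "\<forall>v. Ck_on k S (\<lambda>x. f' x v)"
  using assms by auto

lemma Ck_on_continuous: "Ck_on k S f \<Longrightarrow> continuous_on S f"
  by (cases k) (auto intro: has_derivative_continuous_on)

lemma Ck_on_Suc_imp: "Ck_on (Suc k) S f \<Longrightarrow> Ck_on k S f"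
proof (induction k arbitrary: f)
  case 0
  then show ?case using Ck_on_continuous by (metis Ck_on.simps(1))
next
  case (Suc k)
  from Suc.prems obtain f' where "\<forall>x\<in>S. (f has_derivative f' x) (at x within S)"
    and "\<forall>v. Ck_on (Suc k) S (\<lambda>x. f' x v)" by (rule Ck_on_SucE)
  then show ?case using Suc.IH by (intro Ck_on_SucI) auto
qed

lemma Ck_on_const: "Ck_on k S (\<lambda>x. c)"
proof (induction k arbitrary: c)
  case (Suc k)
  show ?case by (rule Ck_on_SucI[OF has_derivative_const]) (rule Suc)
qed simp

lemma Ck_on_bounded_linear:
  assumes "bounded_linear l" "Ck_on k S f"
  shows "Ck_on k S (\<lambda>x. l (f x))"
  using assms(2)
proof (induction k arbitrary: f)
  case 0
  then show ?case using assms(1) by (simp add: bounded_linear.continuous_on)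
next
  case (Suc k)
  from Suc.prems obtain f' where "\<forall>x\<in>S. (f has_derivative f' x) (at x within S)"
    and "\<forall>v. Ck_on k S (\<lambda>x. f' x v)" by (rule Ck_on_SucE)
  then show ?case using Suc.IH
    by (intro Ck_on_SucI[of _ _ "\<lambda>x v. l (f' x v)"])
      (auto intro: bounded_linear.has_derivative[OF assms(1)])
qed

lemma Ck_on_ident: "Ck_on k S (\<lambda>x. x)"
proof (cases k)
  case (Suc k)
  show ?thesis unfolding Suc by (rule Ck_on_SucI[OF has_derivative_ident]) (rule Ck_on_const)
qed simp

lemma Ck_on_add: "Ck_on k S f \<Longrightarrow> Ck_on k S g \<Longrightarrow> Ck_on k S (\<lambda>x. f x + g x)"
proof (induction k arbitrary: f g)
  case 0
  then show ?case by (simp add: continuous_on_add)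
next
  case (Suc k)
  from Suc.prems(1) obtain f' where "\<forall>x\<in>S. (f has_derivative f' x) (at x within S)"
    and "\<forall>v. Ck_on k S (\<lambda>x. f' x v)" by (rule Ck_on_SucE)
  moreover from Suc.prems(2) obtain g' where "\<forall>x\<in>S. (g has_derivative g' x) (at x within S)"
    and "\<forall>v. Ck_on k S (\<lambda>x. g' x v)" by (rule Ck_on_SucE)
  ultimately show ?case using Suc.IH
    by (intro Ck_on_SucI[of _ _ "\<lambda>x v. f' x v + g' x v"]) (auto intro: has_derivative_add)
qed

lemma Ck_on_sum: "(\<And>i. i \<in> I \<Longrightarrow> Ck_on k S (f i)) \<Longrightarrow> Ck_on k S (\<lambda>x. \<Sum>i\<in>I. f i x)"
  by (induction I rule: infinite_finite_induct) (auto intro: Ck_on_add Ck_on_const)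

lemma Ck_on_scaleR: "Ck_on k S f \<Longrightarrow> Ck_on k S g \<Longrightarrow> Ck_on k S (\<lambda>x. f x *\<^sub>R g x)"
proof (induction k arbitrary: f g)
  case 0
  then show ?case by (simp add: continuous_on_scaleR)
next
  case (Suc k)
  from Suc.prems(1) obtain f' where f': "\<forall>x\<in>S. (f has_derivative f' x) (at x within S)"
    "\<forall>v. Ck_on k S (\<lambda>x. f' x v)" by (rule Ck_on_SucE)
  from Suc.prems(2) obtain g' where g': "\<forall>x\<in>S. (g has_derivative g' x) (at x within S)"
    "\<forall>v. Ck_on k S (\<lambda>x. g' x v)" by (rule Ck_on_SucE)
  show ?case
  proof (rule Ck_on_SucI)
    show "((\<lambda>x. f x *\<^sub>R g x) has_derivative (\<lambda>v. f x *\<^sub>R g' x v + f' x v *\<^sub>R g x)) (at x within S)"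
      if "x \<in> S" for x using f'(1) g'(1) that by (intro has_derivative_scaleR) auto
    show "Ck_on k S (\<lambda>x. f x *\<^sub>R g' x v + f' x v *\<^sub>R g x)" for v
      using Suc.prems f'(2) g'(2) by (intro Ck_on_add Suc.IH) (auto intro: Ck_on_Suc_imp[OF Suc.prems(1)] Ck_on_Suc_imp[OF Suc.prems(2)])
  qed
qed

lemma linear_euclidean_expansion:
  assumes "linear l" shows "l v = (\<Sum>b\<in>Basis. (v \<bullet> b) *\<^sub>R l b)"
proof -
  have "l v = l (\<Sum>b\<in>Basis. (v \<bullet> b) *\<^sub>R b)" by (simp add: euclidean_representation)
  also have "\<dots> = (\<Sum>b\<in>Basis. (v \<bullet> b) *\<^sub>R l b)" using assms by (simp add: linear_sum linear_scale)
  finally show ?thesis .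
qed

text \<open>The derivative of \<open>g \<circ> f\<close> is \<open>g' (f x) (f' x v)\<close>, whose direction depends on \<open>x\<close>; expanding
  it in a basis leaves a finite sum of products to which the induction hypothesis applies.\<close>

lemma Ck_on_compose:
  fixes f :: "'a::real_normed_vector \<Rightarrow> 'b::euclidean_space"
  assumes "Ck_on k S f" "Ck_on k T g" "f ` S \<subseteq> T"
  shows "Ck_on k S (\<lambda>x. g (f x))"
  using assms
proof (induction k arbitrary: f g)
  case 0
  then show ?case by (auto intro: continuous_on_compose2)
next
  case (Suc k)
  from Suc.prems(1) obtain f' where f': "\<forall>x\<in>S. (f has_derivative f' x) (at x within S)"
    "\<forall>v. Ck_on k S (\<lambda>x. f' x v)" by (rule Ck_on_SucE)
  from Suc.prems(2) obtain g' where g': "\<forall>x\<in>T. (g has_derivative g' x) (at x within T)"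
    "\<forall>v. Ck_on k T (\<lambda>x. g' x v)" by (rule Ck_on_SucE)
  show ?case
  proof (rule Ck_on_SucI)
    fix x assume x: "x \<in> S"
    then have "(g has_derivative g' (f x)) (at (f x) within T)" using g' Suc.prems(3) by auto
    then show "((\<lambda>x. g (f x)) has_derivative (\<lambda>v. g' (f x) (f' x v))) (at x within S)"
      using has_derivative_in_compose2[OF _ Suc.prems(3) x f'(1)[THEN bspec, OF x]] g'(1) by blast
  next
    fix v
    have "Ck_on k S (\<lambda>x. \<Sum>b\<in>Basis. (f' x v \<bullet> b) *\<^sub>R g' (f x) b)"
      using Suc.prems g'(2) f'(2)
      by (intro Ck_on_sum Ck_on_scaleR Suc.IH Ck_on_bounded_linear[OF bounded_linear_inner_left])
        (auto intro: Ck_on_Suc_imp[OF Suc.prems(1)])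
    then show "Ck_on k S (\<lambda>x. g' (f x) (f' x v))"
    proof (rule Ck_on_cong)
      fix x assume x: "x \<in> S"
      then have "linear (g' (f x))" using g' Suc.prems(3) has_derivative_linear by blast
      then show "g' (f x) (f' x v) = (\<Sum>b\<in>Basis. (f' x v \<bullet> b) *\<^sub>R g' (f x) b)"
        by (rule linear_euclidean_expansion)
    qed
  qed
qed

lemma Ck_on_Suc_open:
  assumes "Ck_on (Suc k) S f" "open S"
  shows "\<And>x. x \<in> S \<Longrightarrow> f differentiable (at x)"
    and "Ck_on k S (\<lambda>x. frechet_derivative f (at x) v)"
proof -
  from assms(1) obtain f' where f': "\<forall>x\<in>S. (f has_derivative f' x) (at x within S)"
    "\<forall>v. Ck_on k S (\<lambda>x. f' x v)" by (rule Ck_on_SucE)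
  then have f: "(f has_derivative f' x) (at x)" if "x \<in> S" for x
    using that assms(2) by (metis at_within_open)
  then show "\<And>x. x \<in> S \<Longrightarrow> f differentiable (at x)" by (auto simp: differentiable_def)
  show "Ck_on k S (\<lambda>x. frechet_derivative f (at x) v)"
    using spec[OF f'(2), of v] by (rule Ck_on_cong) (metis f frechet_derivative_at)
qed

section \<open>Smoothness near a point\<close>

text \<open>Charts, products of charts and curves overlap only locally, so smoothness is tracked at the
  level of germs: no domains have to be matched when maps are composed. With \<open>S = UNIV\<close> this is
  smoothness on an open neighbourhood, with \<open>S\<close> an interval it applies to curves up to the end
  points.\<close>

definition smooth_near :: "'a::real_normed_vector set \<Rightarrow> ('a \<Rightarrow> 'b::real_normed_vector) \<Rightarrow> 'a \<Rightarrow> bool" where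
  "smooth_near S f x \<longleftrightarrow> x \<in> S \<and> (\<exists>W. open W \<and> x \<in> W \<and> smooth_on (S \<inter> W) f)"

lemma smooth_on_subset: "smooth_on S f \<Longrightarrow> T \<subseteq> S \<Longrightarrow> smooth_on T f"
  unfolding smooth_on_def by (blast intro: Ck_on_subset)

lemma smooth_nearI: "x \<in> S \<Longrightarrow> open W \<Longrightarrow> x \<in> W \<Longrightarrow> smooth_on (S \<inter> W) f \<Longrightarrow> smooth_near S f x"
  unfolding smooth_near_def by blast

lemma smooth_nearE:
  assumes "smooth_near S f x"
  obtains W where "x \<in> S" "open W" "x \<in> W" "smooth_on (S \<inter> W) f"
  using assms unfolding smooth_near_def by blast

lemma smooth_near_mem: "smooth_near S f x \<Longrightarrow> x \<in> S"
  by (simp add: smooth_near_def)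

lemma smooth_near_on: "smooth_on S f \<Longrightarrow> x \<in> S \<Longrightarrow> smooth_near S f x"
  by (rule smooth_nearI[of _ _ UNIV]) auto

lemma smooth_near_continuous:
  assumes "smooth_near S f x" shows "continuous (at x within S) f"
proof -
  from assms obtain W where W: "x \<in> S" "open W" "x \<in> W" "smooth_on (S \<inter> W) f" by (rule smooth_nearE)
  then have "continuous_on (S \<inter> W) f" unfolding smooth_on_def by (blast intro: Ck_on_continuous)
  then have "continuous (at x within (S \<inter> W)) f" using W by (simp add: continuous_on_eq_continuous_within)
  then show ?thesis using W at_within_nhd[of x W S "S \<inter> W"] by (simp add: Int_assoc)
qed

lemma smooth_near_cong:
  assumes "smooth_near S f x" "\<forall>\<^sub>F y in nhds x. y \<in> S \<longrightarrow> g y = f y"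
  shows "smooth_near S g x"
proof -
  from assms(1) obtain W where W: "x \<in> S" "open W" "x \<in> W" "smooth_on (S \<inter> W) f" by (rule smooth_nearE)
  from assms(2) obtain V where V: "open V" "x \<in> V" "\<forall>y\<in>V. y \<in> S \<longrightarrow> g y = f y"
    unfolding eventually_nhds by blast
  have "smooth_on (S \<inter> (W \<inter> V)) f" using W(4) by (rule smooth_on_subset) auto
  then have "smooth_on (S \<inter> (W \<inter> V)) g" using V(3) unfolding smooth_on_def by (blast intro: Ck_on_cong)
  then show ?thesis using W V by (intro smooth_nearI[of _ _ "W \<inter> V"]) auto
qed

lemma smooth_near_eventually:
  assumes "smooth_near S f x" shows "\<forall>\<^sub>F y in nhds x. y \<in> S \<longrightarrow> smooth_near S f y"
  using assms unfolding smooth_near_def eventually_nhds by blast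

lemma smooth_near_const: "x \<in> S \<Longrightarrow> smooth_near S (\<lambda>x. c) x"
  by (rule smooth_near_on) (auto simp: smooth_on_def Ck_on_const)

lemma smooth_near_ident: "x \<in> S \<Longrightarrow> smooth_near S (\<lambda>x. x) x"
  by (rule smooth_near_on) (auto simp: smooth_on_def Ck_on_ident)

lemma smooth_near_bounded_linear:
  assumes "bounded_linear l" "smooth_near S f x" shows "smooth_near S (\<lambda>x. l (f x)) x"
proof -
  from assms(2) obtain W where "x \<in> S" "open W" "x \<in> W" "smooth_on (S \<inter> W) f" by (rule smooth_nearE)
  moreover from this(4) have "smooth_on (S \<inter> W) (\<lambda>x. l (f x))"
    unfolding smooth_on_def using Ck_on_bounded_linear[OF assms(1)] by blast
  ultimately show ?thesis by (intro smooth_nearI)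
qed

lemma smooth_near_binary:
  assumes "smooth_near S f x" "smooth_near S g x"
    and "\<And>k W. Ck_on k (S \<inter> W) f \<Longrightarrow> Ck_on k (S \<inter> W) g \<Longrightarrow> Ck_on k (S \<inter> W) F"
  shows "smooth_near S F x"
proof -
  from assms(1) obtain W where W: "x \<in> S" "open W" "x \<in> W" "smooth_on (S \<inter> W) f" by (rule smooth_nearE)
  from assms(2) obtain V where V: "open V" "x \<in> V" "smooth_on (S \<inter> V) g" by (rule smooth_nearE)
  have "smooth_on (S \<inter> (W \<inter> V)) f" "smooth_on (S \<inter> (W \<inter> V)) g"
    using W(4) V(3) by (auto elim: smooth_on_subset)
  then have "smooth_on (S \<inter> (W \<inter> V)) F" unfolding smooth_on_def using assms(3) by blast
  then show ?thesis using W V by (intro smooth_nearI[of _ _ "W \<inter> V"]) auto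
qed

lemma smooth_near_add: "smooth_near S f x \<Longrightarrow> smooth_near S g x \<Longrightarrow> smooth_near S (\<lambda>x. f x + g x) x"
  by (rule smooth_near_binary[of S f x g]) (auto intro: Ck_on_add)

lemma smooth_near_scaleR:
  "smooth_near S f x \<Longrightarrow> smooth_near S g x \<Longrightarrow> smooth_near S (\<lambda>x. f x *\<^sub>R g x) x"
  by (rule smooth_near_binary[of S f x g]) (auto intro: Ck_on_scaleR)

lemma smooth_near_diff:
  assumes "smooth_near S f x" "smooth_near S g x" shows "smooth_near S (\<lambda>x. f x - g x) x"
  using smooth_near_add[OF assms(1) smooth_near_bounded_linear[OF _ assms(2), of uminus]]
  by (simp add: bounded_linear_minus[OF bounded_linear_ident])

lemma smooth_near_sum:
  assumes "x \<in> S" "\<And>i. i \<in> I \<Longrightarrow> smooth_near S (f i) x" shows "smooth_near S (\<lambda>x. \<Sum>i\<in>I. f i x) x"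
  using assms by (induction I rule: infinite_finite_induct) (auto intro: smooth_near_add smooth_near_const)

lemma smooth_near_Pair:
  assumes "smooth_near S f x" "smooth_near S g x" shows "smooth_near S (\<lambda>x. (f x, g x)) x"
  using smooth_near_add[OF smooth_near_bounded_linear[OF _ assms(1), of "\<lambda>x. (x, 0)"]
      smooth_near_bounded_linear[OF _ assms(2), of "\<lambda>x. (0, x)"]]
  by (simp add: bounded_linear_Pair bounded_linear_ident bounded_linear_zero)

lemma smooth_near_compose:
  fixes f :: "'a::real_normed_vector \<Rightarrow> 'b::euclidean_space"
  assumes "smooth_near UNIV g (f x)" "smooth_near S f x"
  shows "smooth_near S (\<lambda>y. g (f y)) x"
proof -
  from assms(2) obtain W where W: "x \<in> S" "open W" "x \<in> W" "smooth_on (S \<inter> W) f" by (rule smooth_nearE)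
  from assms(1) obtain V where V: "open V" "f x \<in> V" "smooth_on V g" by (auto elim: smooth_nearE)
  have "continuous_on (S \<inter> W) f" using W(4) unfolding smooth_on_def by (blast intro: Ck_on_continuous)
  then obtain U where U: "open U" "U \<inter> (S \<inter> W) = f -` V \<inter> (S \<inter> W)"
    using V(1) unfolding continuous_on_open_invariant by blast
  have "smooth_on (S \<inter> (W \<inter> U)) f" using W(4) by (rule smooth_on_subset) auto
  then have "smooth_on (S \<inter> (W \<inter> U)) (\<lambda>y. g (f y))"
    using V(3) U unfolding smooth_on_def by (blast intro: Ck_on_compose)
  then show ?thesis using W U V by (intro smooth_nearI[of _ _ "W \<inter> U"]) auto
qed

lemma smooth_near_differentiable:
  assumes "smooth_near UNIV f x" shows "f differentiable (at x)"
proof -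
  from assms obtain V where V: "open V" "x \<in> V" "smooth_on V f" by (auto elim: smooth_nearE)
  then show ?thesis unfolding smooth_on_def using Ck_on_Suc_open(1)[of 0 V f x] by blast
qed

lemma smooth_near_has_derivative:
  "smooth_near UNIV f x \<Longrightarrow> (f has_derivative frechet_derivative f (at x)) (at x)"
  using frechet_derivative_works smooth_near_differentiable by blast

lemma smooth_near_frechet_derivative_fixed:
  assumes "smooth_near UNIV f x" shows "smooth_near UNIV (\<lambda>x. frechet_derivative f (at x) v) x"
proof -
  from assms obtain V where V: "open V" "x \<in> V" "smooth_on V f" by (auto elim: smooth_nearE)
  then have "smooth_on V (\<lambda>x. frechet_derivative f (at x) v)"
    unfolding smooth_on_def using Ck_on_Suc_open(2) by blast
  then show ?thesis using V by (intro smooth_nearI[of _ _ V]) auto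
qed

text \<open>Both the base point and the direction may move with \<open>y\<close>; this is how derivatives of chart
  maps along curves and frames arise.\<close>

lemma smooth_near_frechet_derivative:
  fixes f :: "'b::euclidean_space \<Rightarrow> 'c::real_normed_vector"
  assumes f: "smooth_near UNIV f (g x)" and g: "smooth_near S g x" and v: "smooth_near S v x"
  shows "smooth_near S (\<lambda>y. frechet_derivative f (at (g y)) (v y)) x"
proof (rule smooth_near_cong)
  show "smooth_near S (\<lambda>y. \<Sum>b\<in>Basis. (v y \<bullet> b) *\<^sub>R frechet_derivative f (at (g y)) b) x"
  proof (intro smooth_near_sum smooth_near_scaleR)
    show "x \<in> S" using g by (rule smooth_near_mem)
    show "smooth_near S (\<lambda>y. v y \<bullet> b) x" for b
      using v by (rule smooth_near_bounded_linear[OF bounded_linear_inner_left])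
    show "smooth_near S (\<lambda>y. frechet_derivative f (at (g y)) b) x" for b
      using smooth_near_frechet_derivative_fixed[OF f] g
      by (rule smooth_near_compose[where g = "\<lambda>z. frechet_derivative f (at z) b"])
  qed
  have "\<forall>\<^sub>F y in at x within S. smooth_near UNIV f (g y)"
    using smooth_near_eventually[OF f] smooth_near_continuous[OF g]
    by (auto simp: continuous_within intro: eventually_compose_filterlim)
  moreover have "\<forall>\<^sub>F y in nhds x. y \<in> S \<longrightarrow> smooth_near UNIV f (g y)"
    using calculation f by (auto simp: eventually_at_filter elim: eventually_mono)
  ultimately show "\<forall>\<^sub>F y in nhds x. y \<in> S \<longrightarrow> frechet_derivative f (at (g y)) (v y)
      = (\<Sum>b\<in>Basis. (v y \<bullet> b) *\<^sub>R frechet_derivative f (at (g y)) b)"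
    by (auto elim!: eventually_mono intro!: linear_euclidean_expansion
        linear_frechet_derivative smooth_near_differentiable)
qed

lemma partial_frechet_derivative:
  assumes "f differentiable (at (x, u))"
  shows "((\<lambda>u. f (x, u)) has_derivative (\<lambda>v. frechet_derivative f (at (x, u)) (0, v))) (at u)"
    and "((\<lambda>x. f (x, u)) has_derivative (\<lambda>v. frechet_derivative f (at (x, u)) (v, 0))) (at x)"
proof -
  have f: "(f has_derivative frechet_derivative f (at (x, u))) (at (x, u))"
    using assms frechet_derivative_works by blast
  have "((\<lambda>u. (x, u)) has_derivative (\<lambda>v. (0, v))) (at u)"
    and "((\<lambda>x. (x, u)) has_derivative (\<lambda>v. (v, 0))) (at x)" by (auto intro!: derivative_eq_intros)
  from this[THEN diff_chain_at] f
  show "((\<lambda>u. f (x, u)) has_derivative (\<lambda>v. frechet_derivative f (at (x, u)) (0, v))) (at u)"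
    and "((\<lambda>x. f (x, u)) has_derivative (\<lambda>v. frechet_derivative f (at (x, u)) (v, 0))) (at x)"
    by (auto simp: o_def)
qed

lemma smooth_near_partial2:
  fixes f :: "'b::euclidean_space \<times> 'c::euclidean_space \<Rightarrow> 'd::real_normed_vector"
  assumes f: "smooth_near UNIV f (g x, u x)" and g: "smooth_near S g x"
    and u: "smooth_near S u x" and v: "smooth_near S v x"
  shows "smooth_near S (\<lambda>y. frechet_derivative (\<lambda>w. f (g y, w)) (at (u y)) (v y)) x"
proof (rule smooth_near_cong)
  have gu: "smooth_near S (\<lambda>y. (g y, u y)) x" using g u by (rule smooth_near_Pair)
  show "smooth_near S (\<lambda>y. frechet_derivative f (at (g y, u y)) (0, v y)) x"
    using f gu smooth_near_Pair[OF smooth_near_const[OF smooth_near_mem[OF v]] v]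
    by (rule smooth_near_frechet_derivative)
  have "\<forall>\<^sub>F y in at x within S. smooth_near UNIV f (g y, u y)"
    using smooth_near_eventually[OF f] smooth_near_continuous[OF gu]
    by (auto simp: continuous_within intro: eventually_compose_filterlim)
  then have "\<forall>\<^sub>F y in nhds x. y \<in> S \<longrightarrow> smooth_near UNIV f (g y, u y)"
    using f by (auto simp: eventually_at_filter elim: eventually_mono)
  then show "\<forall>\<^sub>F y in nhds x. y \<in> S \<longrightarrow> frechet_derivative (\<lambda>w. f (g y, w)) (at (u y)) (v y)
      = frechet_derivative f (at (g y, u y)) (0, v y)"
    by (auto elim!: eventually_mono dest!: smooth_near_differentiable partial_frechet_derivative(1)
        simp: frechet_derivative_at[symmetric])
qed

lemma smooth_near_partial1:
  fixes f :: "'b::euclidean_space \<times> 'c::euclidean_space \<Rightarrow> 'd::real_normed_vector"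
  assumes f: "smooth_near UNIV f (g x, u x)" and g: "smooth_near S g x"
    and u: "smooth_near S u x" and v: "smooth_near S v x"
  shows "smooth_near S (\<lambda>y. frechet_derivative (\<lambda>w. f (w, u y)) (at (g y)) (v y)) x"
proof -
  have "smooth_near UNIV (\<lambda>z. f (snd z, fst z)) (u x, g x)"
  proof (rule smooth_near_compose)
    show "smooth_near UNIV f (snd (u x, g x), fst (u x, g x))" using f by simp
    show "smooth_near UNIV (\<lambda>z. (snd z, fst z)) (u x, g x)"
      by (intro smooth_near_Pair smooth_near_on) (auto simp: smooth_on_def
          intro: Ck_on_bounded_linear[OF bounded_linear_fst Ck_on_ident]
            Ck_on_bounded_linear[OF bounded_linear_snd Ck_on_ident])
  qed
  from smooth_near_partial2[OF this u g v] show ?thesis by simp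
qed

lemma smooth_near_fst: "smooth_near S f x \<Longrightarrow> smooth_near S (\<lambda>y. fst (f y)) x"
  by (rule smooth_near_bounded_linear[OF bounded_linear_fst])

lemma smooth_near_snd: "smooth_near S f x \<Longrightarrow> smooth_near S (\<lambda>y. snd (f y)) x"
  by (rule smooth_near_bounded_linear[OF bounded_linear_snd])

text \<open>One germ at every point of the interval gives a continuous derivative up to the end points, as
  integration by parts requires.\<close>

lemma smooth_near_vector_derivative:
  fixes f :: "real \<Rightarrow> 'a::real_normed_vector"
  assumes ab: "a < b" and f: "\<And>t. t \<in> {a..b} \<Longrightarrow> smooth_near {a..b} f t"
  shows "\<And>t. t \<in> {a..b} \<Longrightarrow> (f has_vector_derivative vector_derivative f (at t within {a..b})) (at t within {a..b})"
    and "continuous_on {a..b} (\<lambda>t. vector_derivative f (at t within {a..b}))"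
proof -
  have *: "(\<forall>s\<in>{a..b} \<inter> W. (f has_vector_derivative f' s 1) (at s within {a..b})) \<and> continuous_on ({a..b} \<inter> W) (\<lambda>s. f' s 1)
     \<and> (\<forall>s\<in>{a..b} \<inter> W. vector_derivative f (at s within {a..b}) = f' s 1)"
    if "t \<in> {a..b}" "open W"  "\<forall>s\<in>{a..b} \<inter> W. (f has_derivative f' s) (at s within {a..b} \<inter> W)"
      "\<forall>v. Ck_on 0 ({a..b} \<inter> W) (\<lambda>s. f' s v)" for t W f'
  proof -
    have "(f has_vector_derivative f' s 1) (at s within {a..b})" if "s \<in> {a..b} \<inter> W" for s
    proof -
      have d: "(f has_derivative f' s) (at s within {a..b})"
        using \<open>\<forall>s\<in>{a..b} \<inter> W. _\<close> that \<open>open W\<close> at_within_nhd[of s W "{a..b}" "{a..b} \<inter> W"] by (simp add: Int_assoc)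
      have "f' s = (\<lambda>r. r *\<^sub>R f' s 1)"
      proof
        fix r :: real
        show "f' s r = r *\<^sub>R f' s 1"
          using linear_scale[OF has_derivative_linear[OF d], of r 1] by (simp only: real_scaleR_def mult_1_right)
      qed
      then show ?thesis unfolding has_vector_derivative_def by (rule has_derivative_eq_rhs[OF d])
    qed
    moreover have "at s within {a..b} \<noteq> bot" if "s \<in> {a..b}" for s
      using that ab by (simp add: trivial_limit_within islimpt_Icc)
    ultimately show ?thesis using that(4)
      by (auto simp del: atLeastAtMost_iff intro!: vector_derivative_within)
  qed
  have **: "\<exists>W g. open W \<and> t \<in> W \<and> (f has_vector_derivative g t) (at t within {a..b}) \<and> continuous_on ({a..b} \<inter> W) g
     \<and> (\<forall>s\<in>{a..b} \<inter> W. vector_derivative f (at s within {a..b}) = g s)" if t: "t \<in> {a..b}" for t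
  proof -
    from f[OF t] obtain W where W: "open W" "t \<in> W" "smooth_on ({a..b} \<inter> W) f" by (auto elim: smooth_nearE)
    then have "Ck_on (Suc 0) ({a..b} \<inter> W) f" unfolding smooth_on_def by blast
    then obtain f' where "\<forall>s\<in>{a..b} \<inter> W. (f has_derivative f' s) (at s within {a..b} \<inter> W)"
      "\<forall>v. Ck_on 0 ({a..b} \<inter> W) (\<lambda>s. f' s v)" by (rule Ck_on_SucE)
    from *[OF t W(1) this] W t show ?thesis by (intro exI[of _ W] exI[of _ "\<lambda>s. f' s 1"]) blast
  qed
  show "(f has_vector_derivative vector_derivative f (at t within {a..b})) (at t within {a..b})" if "t \<in> {a..b}" for t
    using **[OF that] that by (metis Int_iff)
  show "continuous_on {a..b} (\<lambda>t. vector_derivative f (at t within {a..b}))"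
    unfolding continuous_on_eq_continuous_within
  proof
    fix t assume t: "t \<in> {a..b}"
    from **[OF t] obtain W g where W: "open W" "t \<in> W" "continuous_on ({a..b} \<inter> W) g"
      "\<forall>s\<in>{a..b} \<inter> W. vector_derivative f (at s within {a..b}) = g s" by blast
    have "continuous_on ({a..b} \<inter> W) (\<lambda>t. vector_derivative f (at t within {a..b}))"
      using W(3) by (rule continuous_on_eq) (use W(4) in simp)
    then have "continuous (at t within {a..b} \<inter> W) (\<lambda>t. vector_derivative f (at t within {a..b}))"
      using t W(2) by (simp add: continuous_on_eq_continuous_within)
    then show "continuous (at t within {a..b}) (\<lambda>t. vector_derivative f (at t within {a..b}))"
      using W t at_within_nhd[of t W "{a..b}" "{a..b} \<inter> W"] by (simp add: Int_assoc)
  qed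
qed

lemma smooth_near_blinfun:
  fixes F :: "'a::real_normed_vector \<Rightarrow> 'b::euclidean_space \<Rightarrow>\<^sub>L real"
  assumes "x \<in> S" "\<And>b. b \<in> Basis \<Longrightarrow> smooth_near S (\<lambda>y. blinfun_apply (F y) b) x"
  shows "smooth_near S F x"
proof -
  have "F = (\<lambda>y. \<Sum>b\<in>Basis. blinfun_apply (F y) b *\<^sub>R blinfun_inner_left b)"
    by (intro ext blinfun_euclidean_eqI)
      (simp add: blinfun.sum_left blinfun.scaleR_left inner_Basis if_distrib cong: if_cong)
  moreover have "smooth_near S (\<lambda>y. \<Sum>b\<in>Basis. blinfun_apply (F y) b *\<^sub>R blinfun_inner_left b) x"
    using assms by (intro smooth_near_sum smooth_near_scaleR smooth_near_const)
  ultimately show ?thesis by simp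
qed

lemma smooth_near_tendsto:
  "smooth_near UNIV f x \<Longrightarrow> filterlim f (nhds (f x)) (nhds x)"
  using smooth_near_continuous[of UNIV f x] by (simp add: continuous_within tendsto_at_iff_tendsto_nhds)

lemma smooth_near_eventually_image:
  assumes "smooth_near UNIV f x" "\<forall>\<^sub>F y in nhds (f x). P y"
  shows "\<forall>\<^sub>F z in nhds x. P (f z)"
  using assms(2) smooth_near_tendsto[OF assms(1)] by (rule eventually_compose_filterlim)

lemma eventually_nhds_fst: "\<forall>\<^sub>F x in nhds a. P x \<Longrightarrow> \<forall>\<^sub>F z in nhds (a, b). P (fst z)"
  unfolding nhds_prod by (rule eventually_compose_filterlim[OF _ filterlim_fst])

lemma eventually_nhds_snd: "\<forall>\<^sub>F x in nhds b. P x \<Longrightarrow> \<forall>\<^sub>F z in nhds (a, b). P (snd z)"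
  unfolding nhds_prod by (rule eventually_compose_filterlim[OF _ filterlim_snd])

lemma has_derivative_transform_nhds:
  assumes "(f has_derivative D) (at x)" "\<forall>\<^sub>F y in nhds x. g y = f y"
  shows "(g has_derivative D) (at x)"
proof (rule has_derivative_transform_eventually[OF assms(1)])
  show "\<forall>\<^sub>F y in at x. f y = g y"
    using assms(2) by (auto simp: eventually_at_filter elim: eventually_mono)
  show "f x = g x" using eventually_nhds_x_imp_x[OF assms(2)] by simp
qed simp

lemma frechet_derivative_split:
  assumes "f differentiable (at (x, y))"
  shows "frechet_derivative f (at (x, y)) (u, v) =
    frechet_derivative (\<lambda>z. f (z, y)) (at x) u + frechet_derivative (\<lambda>w. f (x, w)) (at y) v"
proof -
  have "linear (frechet_derivative f (at (x, y)))" using assms by (rule linear_frechet_derivative)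
  from linear_add[OF this, of "(u, 0)" "(0, v)"] show ?thesis
    by (simp add: frechet_derivative_at[OF partial_frechet_derivative(1)[OF assms], symmetric]
        frechet_derivative_at[OF partial_frechet_derivative(2)[OF assms], symmetric])
qed

lemma smooth_near_differentiable_within:
  assumes "smooth_near S f x" shows "f differentiable (at x within S)"
proof -
  from assms obtain W where W: "x \<in> S" "open W" "x \<in> W" "smooth_on (S \<inter> W) f" by (rule smooth_nearE)
  then have "Ck_on (Suc 0) (S \<inter> W) f" unfolding smooth_on_def by blast
  then have "f differentiable (at x within S \<inter> W)" using W by (auto simp: differentiable_def)
  then show ?thesis using W at_within_nhd[of x W S "S \<inter> W"] by (simp add: Int_assoc)
qed

lemma frechet_derivative_eqI: "(f has_derivative D) (at x) \<Longrightarrow> frechet_derivative f (at x) v = D v"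
  using frechet_derivative_at by metis

lemma smooth_near_blinfun_apply:
  fixes \<phi> :: "'a::real_normed_vector \<Rightarrow> 'b::euclidean_space \<Rightarrow>\<^sub>L real"
  assumes "smooth_near S \<phi> x" "smooth_near S v x"
  shows "smooth_near S (\<lambda>y. blinfun_apply (\<phi> y) (v y)) x"
proof -
  have "smooth_near S (\<lambda>y. \<Sum>b\<in>Basis. (v y \<bullet> b) *\<^sub>R blinfun_apply (\<phi> y) b) x"
    using assms
    by (intro smooth_near_sum smooth_near_scaleR smooth_near_mem[OF assms(1)]
        smooth_near_bounded_linear[OF bounded_linear_inner_left]
        smooth_near_bounded_linear[OF blinfun.bounded_linear_left])
  moreover have "(\<Sum>b\<in>Basis. (v y \<bullet> b) *\<^sub>R blinfun_apply (\<phi> y) b) = blinfun_apply (\<phi> y) (v y)" for y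
    by (rule linear_euclidean_expansion[symmetric]) (simp add: blinfun.bounded_linear_right bounded_linear.linear)
  ultimately show ?thesis by simp
qed

lemma smooth_near_has_vector_derivative:
  "smooth_near S f t \<Longrightarrow> (f has_vector_derivative vector_derivative f (at t within S)) (at t within S)"
  using smooth_near_differentiable_within vector_derivative_works by blast

subsection \<open>Symmetry of the second derivative\<close>

text \<open>Two applications of the mean value theorem express the second difference
  \<open>f (x + s b + s c) - f (x + s b) - f (x + s c) + f x\<close>, which is symmetric in \<open>b\<close> and \<open>c\<close>, as
  \<open>s\<^sup>2\<close> times a mixed second derivative at a point close to \<open>x\<close>.\<close>

lemma second_difference_mean_value:
  fixes f :: "'a::euclidean_space \<Rightarrow> real"
  assumes f: "\<And>y. y \<in> ball x r \<Longrightarrow> f differentiable (at y)"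
    and f2: "\<And>y. y \<in> ball x r \<Longrightarrow> (\<lambda>z. frechet_derivative f (at z) b) differentiable (at y)"
    and s: "0 < s" "s * (norm b + norm c) < r"
  shows "\<exists>y\<in>ball x r. f (x + s *\<^sub>R b + s *\<^sub>R c) - f (x + s *\<^sub>R b) - f (x + s *\<^sub>R c) + f x
    = s^2 * frechet_derivative (\<lambda>z. frechet_derivative f (at z) b) (at y) c"
proof -
  have in_ball: "x + p *\<^sub>R b + q *\<^sub>R c \<in> ball x r" if "0 \<le> p" "p \<le> s" "0 \<le> q" "q \<le> s" for p q
  proof -
    have "norm (p *\<^sub>R b + q *\<^sub>R c) \<le> p * norm b + q * norm c"
      using norm_triangle_ineq[of "p *\<^sub>R b" "q *\<^sub>R c"] that by simp
    also have "\<dots> \<le> s * (norm b + norm c)"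
      using that by (simp add: distrib_left add_mono mult_right_mono)
    finally show ?thesis using s(2) by (simp add: dist_norm norm_minus_commute add.assoc flip: norm_minus_cancel[of "p *\<^sub>R b + q *\<^sub>R c"])
  qed
  let ?D = "\<lambda>z. frechet_derivative f (at z) b"
  define \<phi> where "\<phi> p = f (x + p *\<^sub>R b + s *\<^sub>R c) - f (x + p *\<^sub>R b + 0 *\<^sub>R c)" for p
  have fD: "((\<lambda>p. f (x + p *\<^sub>R b + q *\<^sub>R c)) has_derivative (\<lambda>v. v * ?D (x + p *\<^sub>R b + q *\<^sub>R c))) (at p within {0..s})"
    if "0 \<le> p" "p \<le> s" "0 \<le> q" "q \<le> s" for p q
  proof -
    have df: "(f has_derivative frechet_derivative f (at (x + p *\<^sub>R b + q *\<^sub>R c))) (at (x + p *\<^sub>R b + q *\<^sub>R c))"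
      using f[OF in_ball[OF that]] frechet_derivative_works by blast
    have "((\<lambda>p. x + p *\<^sub>R b + q *\<^sub>R c) has_derivative (\<lambda>v. v *\<^sub>R b)) (at p within {0..s})"
      by (auto intro!: derivative_eq_intros)
    from diff_chain_within[OF this has_derivative_at_withinI[OF df]] show ?thesis
      by (simp add: o_def linear_scale[OF has_derivative_linear[OF df]])
  qed
  have "\<exists>p\<in>{0..s}. \<phi> s - \<phi> 0 = (s - 0) * ?D (x + p *\<^sub>R b + s *\<^sub>R c) - (s - 0) * ?D (x + p *\<^sub>R b + 0 *\<^sub>R c)"
    unfolding \<phi>_def using s(1)
    by (intro mvt_very_simple[where f' = "\<lambda>p v. v * ?D (x + p *\<^sub>R b + s *\<^sub>R c) - v * ?D (x + p *\<^sub>R b + 0 *\<^sub>R c)"]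
       has_derivative_diff fD) auto
  then obtain p where p: "0 \<le> p" "p \<le> s"
    "\<phi> s - \<phi> 0 = s * (?D (x + p *\<^sub>R b + s *\<^sub>R c) - ?D (x + p *\<^sub>R b + 0 *\<^sub>R c))"
    by (auto simp: right_diff_distrib)
  have dD: "((\<lambda>q. ?D (x + p *\<^sub>R b + q *\<^sub>R c)) has_derivative (\<lambda>v. v * frechet_derivative ?D (at (x + p *\<^sub>R b + q *\<^sub>R c)) c)) (at q within {0..s})"
    if "0 \<le> q" "q \<le> s" for q
  proof -
    have df: "(?D has_derivative frechet_derivative ?D (at (x + p *\<^sub>R b + q *\<^sub>R c))) (at (x + p *\<^sub>R b + q *\<^sub>R c))"
      using f2[OF in_ball[OF p(1,2) that]] frechet_derivative_works by blast
    have "((\<lambda>q. x + p *\<^sub>R b + q *\<^sub>R c) has_derivative (\<lambda>v. v *\<^sub>R c)) (at q within {0..s})"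
      by (auto intro!: derivative_eq_intros)
    from diff_chain_within[OF this has_derivative_at_withinI[OF df]] show ?thesis
      by (simp add: o_def linear_scale[OF has_derivative_linear[OF df]])
  qed
  have "\<exists>q\<in>{0..s}. ?D (x + p *\<^sub>R b + s *\<^sub>R c) - ?D (x + p *\<^sub>R b + 0 *\<^sub>R c)
      = (s - 0) * frechet_derivative ?D (at (x + p *\<^sub>R b + q *\<^sub>R c)) c"
    using s(1) by (intro mvt_very_simple[where f' = "\<lambda>q v. v * frechet_derivative ?D (at (x + p *\<^sub>R b + q *\<^sub>R c)) c"] dD) auto
  then obtain q where q: "0 \<le> q" "q \<le> s"
    "?D (x + p *\<^sub>R b + s *\<^sub>R c) - ?D (x + p *\<^sub>R b + 0 *\<^sub>R c) = s * frechet_derivative ?D (at (x + p *\<^sub>R b + q *\<^sub>R c)) c"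
    by auto
  have "\<phi> s - \<phi> 0 = s^2 * frechet_derivative ?D (at (x + p *\<^sub>R b + q *\<^sub>R c)) c"
    unfolding p(3) q(3) by (simp add: power2_eq_square)
  then show ?thesis using in_ball[OF p(1,2) q(1,2)] unfolding \<phi>_def by (intro bexI) (auto simp: algebra_simps)
qed

lemma second_derivative_symmetric_real:
  fixes f :: "'a::euclidean_space \<Rightarrow> real"
  assumes f: "smooth_near UNIV f x"
  shows "frechet_derivative (\<lambda>z. frechet_derivative f (at z) b) (at x) c
    = frechet_derivative (\<lambda>z. frechet_derivative f (at z) c) (at x) b"
proof -
  define D where "D b c y = frechet_derivative (\<lambda>z. frechet_derivative f (at z) b) (at y) c" for b c y
  have cont: "(D b c \<longlongrightarrow> D b c x) (at x)" for b c
    using smooth_near_continuous[OF smooth_near_frechet_derivative_fixed[OF smooth_near_frechet_derivative_fixed[OF f]]]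
    unfolding D_def continuous_within .
  have near: "\<forall>\<^sub>F y in nhds x. smooth_near UNIV f y" using smooth_near_eventually[OF f] by simp
  have bound: "\<bar>D b c x - D c b x\<bar> \<le> 2 * e" if e: "e > 0" for e
  proof -
    have "\<forall>\<^sub>F y in nhds x. \<bar>D b c y - D b c x\<bar> < e" for b c
      using tendstoD[OF cont e, of b c] e by (auto simp: dist_real_def eventually_at_filter elim: eventually_mono)
    from near this[of b c] this[of c b]
    have "\<forall>\<^sub>F y in nhds x. smooth_near UNIV f y \<and> \<bar>D b c y - D b c x\<bar> < e \<and> \<bar>D c b y - D c b x\<bar> < e"
      by eventually_elim auto
    then obtain r where r: "r > 0" "\<And>y. y \<in> ball x r \<Longrightarrow> smooth_near UNIV f y"
      "\<And>y. y \<in> ball x r \<Longrightarrow> \<bar>D b c y - D b c x\<bar> < e" "\<And>y. y \<in> ball x r \<Longrightarrow> \<bar>D c b y - D c b x\<bar> < e"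
      unfolding eventually_nhds_metric by (auto simp: dist_commute)
    define s where "s = r / (2 * (norm b + norm c + 1))"
    have N: "norm b + norm c + 1 > 0" by (simp add: add_nonneg_pos)
    then have s0: "s > 0" using r(1) unfolding s_def by (intro divide_pos_pos) auto
    have "r = s * (2 * (norm b + norm c + 1))" using N unfolding s_def by simp
    then have "r = 2 * (s * (norm b + norm c)) + 2 * s" by (simp add: algebra_simps)
    moreover have "s * (norm b + norm c) \<ge> 0" using s0 by simp
    ultimately have "s * (norm b + norm c) < r" using s0 by linarith
    then have s: "s > 0" "s * (norm b + norm c) < r" "s * (norm c + norm b) < r"
      using s0 by (auto simp: add.commute[of "norm c"])
    have d: "f differentiable (at y)" "(\<lambda>z. frechet_derivative f (at z) v) differentiable (at y)" if "y \<in> ball x r" for y v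
      using smooth_near_differentiable[OF r(2)[OF that]]
        smooth_near_differentiable[OF smooth_near_frechet_derivative_fixed[OF r(2)[OF that]]] .
    let ?\<Delta> = "f (x + s *\<^sub>R b + s *\<^sub>R c) - f (x + s *\<^sub>R b) - f (x + s *\<^sub>R c) + f x"
    obtain y where y: "y \<in> ball x r" "?\<Delta> = s^2 * D b c y"
      using second_difference_mean_value[of x r f b s c] d s unfolding D_def by blast
    obtain z where z: "z \<in> ball x r" "?\<Delta> = s^2 * D c b z"
      using second_difference_mean_value[of x r f c s b] d s unfolding D_def by (auto simp: algebra_simps)
    have "D b c y = D c b z" using y(2) z(2) s(1) by simp
    then show ?thesis using r(3)[OF y(1)] r(4)[OF z(1)] by linarith
  qed
  then have "\<bar>D b c x - D c b x\<bar> \<le> 0 + e" if "e > 0" for e using bound[of "e / 2"] that by simp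
  then have "\<bar>D b c x - D c b x\<bar> \<le> 0" by (rule field_le_epsilon)
  then have "D b c x = D c b x" by simp
  then show ?thesis by (simp add: D_def)
qed

lemma frechet_derivative_bounded_linear:
  assumes "bounded_linear l" "f differentiable (at x)"
  shows "frechet_derivative (\<lambda>y. l (f y)) (at x) v = l (frechet_derivative f (at x) v)"
  using bounded_linear.has_derivative[OF assms(1) frechet_derivative_works[THEN iffD1, OF assms(2)]]
  by (simp add: frechet_derivative_at[symmetric])

lemma second_derivative_symmetric:
  fixes f :: "'a::euclidean_space \<Rightarrow> 'b::euclidean_space"
  assumes f: "smooth_near UNIV f x"
  shows "frechet_derivative (\<lambda>z. frechet_derivative f (at z) b) (at x) c
    = frechet_derivative (\<lambda>z. frechet_derivative f (at z) c) (at x) b"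
proof (rule euclidean_eqI)
  fix i :: 'b assume "i \<in> Basis"
  have l: "bounded_linear (\<lambda>y::'b. y \<bullet> i)" by (rule bounded_linear_inner_left)
  have near: "\<forall>\<^sub>F y in nhds x. smooth_near UNIV f y" using smooth_near_eventually[OF f] by simp
  have "frechet_derivative (\<lambda>z. frechet_derivative f (at z) b) (at x) c \<bullet> i
      = frechet_derivative (\<lambda>z. frechet_derivative (\<lambda>y. f y \<bullet> i) (at z) b) (at x) c" for b c
  proof -
    have diff: "(\<lambda>z. frechet_derivative f (at z) b) differentiable (at x)"
      using smooth_near_differentiable[OF smooth_near_frechet_derivative_fixed[OF f]] .
    from near obtain V where V: "open V" "x \<in> V" "\<And>y. y \<in> V \<Longrightarrow> smooth_near UNIV f y" unfolding eventually_nhds by blast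
    have "frechet_derivative (\<lambda>z. frechet_derivative f (at z) b) (at x) c \<bullet> i
       = frechet_derivative (\<lambda>z. frechet_derivative f (at z) b \<bullet> i) (at x) c"
      using frechet_derivative_bounded_linear[OF l diff] by simp
    also have "\<dots> = frechet_derivative (\<lambda>z. frechet_derivative (\<lambda>y. f y \<bullet> i) (at z) b) (at x) c"
    proof (rule fun_cong[OF frechet_derivative_transform_within_open[OF _ V(1,2)]])
      show "(\<lambda>z. frechet_derivative f (at z) b \<bullet> i) differentiable at x"
        using diff by (rule differentiable_inner[OF _ differentiable_const])
    qed (simp add: frechet_derivative_bounded_linear[OF l] smooth_near_differentiable V(3))
    finally show ?thesis .
  qed
  then show "frechet_derivative (\<lambda>z. frechet_derivative f (at z) b) (at x) c \<bullet> i
    = frechet_derivative (\<lambda>z. frechet_derivative f (at z) c) (at x) b \<bullet> i"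
    using second_derivative_symmetric_real[OF smooth_near_bounded_linear[OF l f]] by simp
qed

section \<open>Atlases\<close>

text \<open>Compatibility of charts in terms of germs. It is inherited by \<open>TM\<close> and by products, so that
  every chart formula below also holds on \<open>TM\<close>, where it describes \<open>TTM\<close>.\<close>

definition smooth_atlas :: "('m, 'e::euclidean_space) chart set \<Rightarrow> bool" where
  "smooth_atlas A \<longleftrightarrow> (\<forall>c\<in>A. inj_on (coords c) (cdom c)) \<and>
     (\<forall>c\<in>A. \<forall>c'\<in>A. open (coords c ` (cdom c \<inter> cdom c')) \<and>
        (\<forall>p\<in>cdom c \<inter> cdom c'. smooth_near UNIV (\<lambda>x. coords c' (cinv c x)) (coords c p)))"

lemma smooth_manifold_imp_smooth_atlas:
  assumes "smooth_manifold A" shows "smooth_atlas A"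
  unfolding smooth_atlas_def
proof (intro conjI ballI)
  fix c c' assume c: "c \<in> A" "c' \<in> A"
  show "inj_on (coords c) (cdom c)" using assms c unfolding smooth_manifold_def by blast
  show o: "open (coords c ` (cdom c \<inter> cdom c'))" using assms c unfolding smooth_manifold_def by blast
  fix p assume "p \<in> cdom c \<inter> cdom c'"
  then show "smooth_near UNIV (\<lambda>x. coords c' (cinv c x)) (coords c p)"
    using assms c o unfolding smooth_manifold_def
    by (intro smooth_nearI[of _ _ "coords c ` (cdom c \<inter> cdom c')"]) (auto simp: o_def)
qed

lemma cinv_coords: "smooth_atlas A \<Longrightarrow> c \<in> A \<Longrightarrow> p \<in> cdom c \<Longrightarrow> cinv c (coords c p) = p"
  unfolding cinv_def smooth_atlas_def by (simp add: inv_into_f_f)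

lemma smooth_near_transition:
  "smooth_atlas A \<Longrightarrow> c \<in> A \<Longrightarrow> c' \<in> A \<Longrightarrow> p \<in> cdom c \<Longrightarrow> p \<in> cdom c'
    \<Longrightarrow> smooth_near UNIV (\<lambda>x. coords c' (cinv c x)) (coords c p)"
  unfolding smooth_atlas_def by blast

lemma chart_at:
  assumes "c \<in> A" "p \<in> cdom c" shows "chart_at A p \<in> A" "p \<in> cdom (chart_at A p)"
  using someI[of "\<lambda>c. c \<in> A \<and> p \<in> cdom c" c] assms by (auto simp: chart_at_def)

lemma eventually_cinv:
  assumes A: "smooth_atlas A" "c \<in> A" "c' \<in> A" "p \<in> cdom c" "p \<in> cdom c'"
  shows "\<forall>\<^sub>F x in nhds (coords c p). cinv c x \<in> cdom c \<and> cinv c x \<in> cdom c' \<and> coords c (cinv c x) = x"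
  unfolding eventually_nhds
  using assms cinv_coords[OF A(1,2)] unfolding smooth_atlas_def
  by (intro exI[of _ "coords c ` (cdom c \<inter> cdom c')"]) auto

lemma eventually_change_chart:
  assumes A: "smooth_atlas A" "c \<in> A" "c' \<in> A" "p \<in> cdom c" "p \<in> cdom c'"
  shows "\<forall>\<^sub>F x in nhds (coords c p). cinv c x = cinv c' (coords c' (cinv c x))"
  using eventually_cinv[OF A] by eventually_elim (simp add: cinv_coords[OF A(1,3)])

lemma smooth_near_change_chart:
  assumes A: "smooth_atlas A" "c \<in> A" "c' \<in> A" "p \<in> cdom c" "p \<in> cdom c'"
    and f: "smooth_near UNIV (\<lambda>x. f (cinv c' x)) (coords c' p)"
  shows "smooth_near UNIV (\<lambda>x. f (cinv c x)) (coords c p)"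
proof (rule smooth_near_cong)
  show "smooth_near UNIV (\<lambda>x. f (cinv c' (coords c' (cinv c x)))) (coords c p)"
    using smooth_near_compose[of "\<lambda>x. f (cinv c' x)" "\<lambda>x. coords c' (cinv c x)", OF _ smooth_near_transition[OF A]] f
    by (simp add: cinv_coords[OF A(1,2,4)])
  show "\<forall>\<^sub>F x in nhds (coords c p). x \<in> UNIV \<longrightarrow> f (cinv c x) = f (cinv c' (coords c' (cinv c x)))"
    using eventually_change_chart[OF A] by eventually_elim simp
qed

text \<open>The components of tangent vectors at \<open>p\<close> transform by this map. In particular it relates the
  components in the chart assigned to \<open>p\<close>, by which tangent vectors are represented, to those
  in a chart that stays fixed while \<open>p\<close> moves.\<close>

definition transition_deriv :: "('m, 'e::euclidean_space) chart \<Rightarrow> ('m, 'e) chart \<Rightarrow> 'm \<Rightarrow> 'e \<Rightarrow> 'e" where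
  "transition_deriv c c' p = frechet_derivative (\<lambda>x. coords c' (cinv c x)) (at (coords c p))"

lemma transition_has_derivative:
  "smooth_atlas A \<Longrightarrow> c \<in> A \<Longrightarrow> c' \<in> A \<Longrightarrow> p \<in> cdom c \<Longrightarrow> p \<in> cdom c'
    \<Longrightarrow> ((\<lambda>x. coords c' (cinv c x)) has_derivative transition_deriv c c' p) (at (coords c p))"
  unfolding transition_deriv_def by (intro smooth_near_has_derivative smooth_near_transition)

lemma has_derivative_change_chart:
  assumes A: "smooth_atlas A" "c \<in> A" "c' \<in> A" "p \<in> cdom c" "p \<in> cdom c'"
    and f: "((\<lambda>x. f (cinv c' x)) has_derivative D) (at (coords c' p))"
  shows "((\<lambda>x. f (cinv c x)) has_derivative (\<lambda>v. D (transition_deriv c c' p v))) (at (coords c p))"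
proof (rule has_derivative_transform_nhds)
  show "((\<lambda>x. f (cinv c' (coords c' (cinv c x)))) has_derivative (\<lambda>v. D (transition_deriv c c' p v))) (at (coords c p))"
    using diff_chain_at[OF transition_has_derivative[OF A], of "\<lambda>x. f (cinv c' x)" D] f
    by (simp add: o_def cinv_coords[OF A(1,2,4)])
  show "\<forall>\<^sub>F x in nhds (coords c p). f (cinv c x) = f (cinv c' (coords c' (cinv c x)))"
    using eventually_change_chart[OF A] by eventually_elim simp
qed

lemma transition_deriv_trans:
  assumes A: "smooth_atlas A" "c \<in> A" "c' \<in> A" "p \<in> cdom c" "p \<in> cdom c'" and c'': "c'' \<in> A" "p \<in> cdom c''"
  shows "transition_deriv c' c'' p (transition_deriv c c' p v) = transition_deriv c c'' p v"
  using has_derivative_unique[OF has_derivative_change_chart[OF A transition_has_derivative[OF A(1,3) c''(1) A(5) c''(2)]]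
      transition_has_derivative[OF A(1,2) c''(1) A(4) c''(2)]] by (rule fun_cong)

lemma transition_deriv_refl:
  assumes A: "smooth_atlas A" "c \<in> A" "p \<in> cdom c"
  shows "transition_deriv c c p v = v"
proof -
  have "((\<lambda>x. coords c (cinv c x)) has_derivative (\<lambda>v. v)) (at (coords c p))"
    using eventually_cinv[OF A(1,2,2,3,3)]
    by (intro has_derivative_transform_nhds[OF has_derivative_ident]) (auto elim: eventually_mono)
  from has_derivative_unique[OF transition_has_derivative[OF A(1,2,2,3,3)] this] show ?thesis by simp
qed

subsection \<open>The tangent atlas\<close>

lemma cdom_tangent_chart: "cdom (tangent_chart A c) = cdom c \<times> UNIV"
  by (simp add: tangent_chart_def)

lemma tangent_chart_in: "c \<in> A \<Longrightarrow> tangent_chart A c \<in> tangent_atlas A"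
  by (simp add: tangent_atlas_def)

lemma coords_tangent_chart:
  "coords (tangent_chart A c) (p, v) = (coords c p, transition_deriv (chart_at A p) c p v)"
  by (simp add: tangent_chart_def transition_deriv_def o_def)

lemma coords_tangent_chart_surj:
  assumes A: "smooth_atlas A" "c \<in> A" "p \<in> cdom c"
  shows "coords (tangent_chart A c) (p, transition_deriv c (chart_at A p) p w) = (coords c p, w)"
  using A chart_at[OF A(2,3)]
  by (simp add: coords_tangent_chart transition_deriv_trans[of A] transition_deriv_refl[of A])

lemma inj_on_tangent_chart:
  assumes A: "smooth_atlas A" "c \<in> A"
  shows "inj_on (coords (tangent_chart A c)) (cdom (tangent_chart A c))"
proof (rule inj_onI, clarsimp simp: cdom_tangent_chart coords_tangent_chart)
  fix p v q w assume *: "p \<in> cdom c" "q \<in> cdom c" "coords c p = coords c q"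
    "transition_deriv (chart_at A p) c p v = transition_deriv (chart_at A q) c q w"
  have "p = q" using *(1-3) cinv_coords[OF A] by metis
  moreover have "transition_deriv c (chart_at A p) p (transition_deriv (chart_at A p) c p v) = v"
    if "p \<in> cdom c" for p v
    using chart_at[OF A(2) that] A that by (simp add: transition_deriv_trans[of A] transition_deriv_refl[of A])
  ultimately show "p = q \<and> v = w" using * by metis
qed

lemma cinv_tangent_chart:
  assumes A: "smooth_atlas A" "c \<in> A" "p \<in> cdom c"
  shows "cinv (tangent_chart A c) (coords c p, w) = (p, transition_deriv c (chart_at A p) p w)"
  unfolding cinv_def
  by (rule inv_into_f_eq[OF inj_on_tangent_chart[OF A(1,2)]])
    (simp_all add: cdom_tangent_chart A coords_tangent_chart_surj)

lemma smooth_atlas_tangent: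
  fixes A :: "('m, 'e::euclidean_space) chart set"
  assumes A: "smooth_atlas A" shows "smooth_atlas (tangent_atlas A)"
  unfolding smooth_atlas_def
proof (intro conjI ballI)
  show "inj_on (coords C) (cdom C)" if "C \<in> tangent_atlas A" for C
    using that inj_on_tangent_chart[OF A] by (auto simp: tangent_atlas_def)
  fix C C' assume "C \<in> tangent_atlas A" "C' \<in> tangent_atlas A"
  then obtain c c' where c: "c \<in> A" "C = tangent_chart A c" "c' \<in> A" "C' = tangent_chart A c'"
    by (auto simp: tangent_atlas_def)
  have "coords C ` (cdom C \<inter> cdom C') = coords c ` (cdom c \<inter> cdom c') \<times> UNIV"
  proof (intro equalityI subsetI)
    fix z assume "z \<in> coords c ` (cdom c \<inter> cdom c') \<times> (UNIV :: 'e set)"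
    then obtain p w where "p \<in> cdom c" "p \<in> cdom c'" "z = (coords c p, w)" by auto
    then show "z \<in> coords C ` (cdom C \<inter> cdom C')"
      unfolding c cdom_tangent_chart
      using coords_tangent_chart_surj[OF A c(1), of p w]
      by (intro image_eqI[of _ _ "(p, transition_deriv c (chart_at A p) p w)"]) auto
  qed (auto simp: c cdom_tangent_chart coords_tangent_chart)
  moreover have "open (coords c ` (cdom c \<inter> cdom c'))" using A c unfolding smooth_atlas_def by blast
  ultimately show "open (coords C ` (cdom C \<inter> cdom C'))" by (simp add: open_Times)
  fix P assume "P \<in> cdom C \<inter> cdom C'"
  then obtain p v where p: "p \<in> cdom c" "p \<in> cdom c'" "P = (p, v)" by (auto simp: c cdom_tangent_chart)
  let ?\<tau> = "\<lambda>x. coords c' (cinv c x)"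
  let ?w = "transition_deriv (chart_at A p) c p v"
  note \<tau> = smooth_near_transition[OF A c(1,3) p(1,2)]
  have "smooth_near UNIV (\<lambda>z. (?\<tau> (fst z), frechet_derivative ?\<tau> (at (fst z)) (snd z))) (coords c p, ?w)"
    using \<tau> by (intro smooth_near_Pair smooth_near_compose[of ?\<tau> fst] smooth_near_frechet_derivative[of ?\<tau> fst]
        smooth_near_fst smooth_near_snd smooth_near_ident UNIV_I) simp_all
  moreover have "\<forall>\<^sub>F z in nhds (coords c p, ?w). coords C' (cinv C z) = (?\<tau> (fst z), frechet_derivative ?\<tau> (at (fst z)) (snd z))"
    using eventually_nhds_fst[OF eventually_cinv[OF A c(1,3) p(1,2)]]
  proof eventually_elim
    case (elim z)
    then have q: "cinv c (fst z) \<in> cdom c" "cinv c (fst z) \<in> cdom c'" "coords c (cinv c (fst z)) = fst z" by auto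
    from cinv_tangent_chart[OF A c(1) q(1), of "snd z"] chart_at[OF c(1) q(1)] q
    show ?case unfolding c
      by (simp add: coords_tangent_chart transition_deriv_trans[OF A c(1)] c(3))
         (simp add: transition_deriv_def)
  qed
  ultimately show "smooth_near UNIV (\<lambda>x. coords C' (cinv C x)) (coords C P)"
    unfolding p(3) c(2) coords_tangent_chart by (rule smooth_near_cong[OF _ eventually_mono]) simp
qed

subsection \<open>Smooth maps in charts\<close>

text \<open>Smoothness provides some pair of charts at each point; compatibility of the atlases carries it
  to any given pair.\<close>

lemma smooth_map_charts:
  assumes A: "smooth_atlas A" and B: "smooth_atlas B" and F: "smooth_map A B F"
    and c: "c \<in> A" "p \<in> cdom c" and c': "c' \<in> B" "F p \<in> cdom c'"
  shows "smooth_near UNIV (\<lambda>x. coords c' (F (cinv c x))) (coords c p)"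
    and "\<forall>\<^sub>F x in nhds (coords c p). F (cinv c x) \<in> cdom c'"
proof -
  have "p \<in> points A" using c by (auto simp: points_def)
  then obtain c1 c1' W where c1: "c1 \<in> A" "c1' \<in> B" "p \<in> cdom c1" "open W" "coords c1 p \<in> W"
    "(F \<circ> cinv c1) ` W \<subseteq> cdom c1'" "smooth_on W (coords c1' \<circ> F \<circ> cinv c1)"
    using F unfolding smooth_map_def by blast
  define f where "f x = coords c1' (F (cinv c1 x))" for x
  have f: "smooth_near UNIV f (coords c1 p)"
    using c1 unfolding f_def by (intro smooth_nearI[of _ _ W]) (auto simp: o_def)
  have Fp: "F p \<in> cdom c1'" and fp: "f (coords c1 p) = coords c1' (F p)"
    using c1(5,6) cinv_coords[OF A c1(1,3)] by (auto simp: f_def)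
  have W: "\<forall>\<^sub>F x in nhds (coords c1 p). x \<in> W" using c1(4,5) by (rule eventually_nhds_in_open)
  have "open (coords c1' ` (cdom c1' \<inter> cdom c'))" using B c1 c' unfolding smooth_atlas_def by blast
  then have "\<forall>\<^sub>F y in nhds (f (coords c1 p)). y \<in> coords c1' ` (cdom c1' \<inter> cdom c')"
    using Fp c'(2) fp by (intro eventually_nhds_in_open) auto
  from smooth_near_eventually_image[OF f this] W
  have ev1: "\<forall>\<^sub>F x in nhds (coords c1 p). F (cinv c1 x) \<in> cdom c'"
  proof eventually_elim
    case (elim x)
    have "F (cinv c1 x) \<in> cdom c1'" using elim c1(6) by auto
    moreover from elim(1) obtain q where q: "q \<in> cdom c1'" "q \<in> cdom c'" "coords c1' (F (cinv c1 x)) = coords c1' q"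
      unfolding f_def by auto
    ultimately have "F (cinv c1 x) = q" using B c1(2) unfolding smooth_atlas_def by (auto dest: inj_onD)
    then show ?case using q by simp
  qed
  have "smooth_near UNIV (\<lambda>x. coords c' (cinv c1' (f x))) (coords c1 p)"
    using smooth_near_compose[of "\<lambda>x. coords c' (cinv c1' x)", OF _ f]
      smooth_near_transition[OF B c1(2) c'(1) Fp c'(2)] by (simp add: fp)
  moreover have "\<forall>\<^sub>F x in nhds (coords c1 p). coords c' (F (cinv c1 x)) = coords c' (cinv c1' (f x))"
    using W by eventually_elim (use c1(6) cinv_coords[OF B c1(2)] in \<open>auto simp: f_def\<close>)
  ultimately have "smooth_near UNIV (\<lambda>x. coords c' (F (cinv c1 x))) (coords c1 p)"
    by (rule smooth_near_cong[OF _ eventually_mono]) simp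
  then show "smooth_near UNIV (\<lambda>x. coords c' (F (cinv c x))) (coords c p)"
    by (rule smooth_near_change_chart[OF A c(1) c1(1) c(2) c1(3)])
  have "\<forall>\<^sub>F x in nhds (coords c1 (cinv c (coords c p))). F (cinv c1 x) \<in> cdom c'"
    using ev1 by (simp add: cinv_coords[OF A c])
  from smooth_near_eventually_image[OF smooth_near_transition[OF A c(1) c1(1) c(2) c1(3)] this]
    eventually_change_chart[OF A c(1) c1(1) c(2) c1(3)]
  show "\<forall>\<^sub>F x in nhds (coords c p). F (cinv c x) \<in> cdom c'" by eventually_elim simp
qed

lemma smooth_atlas_euclidean: "smooth_atlas (euclidean_atlas :: ('e::euclidean_space, 'e) chart set)"
proof -
  have "cinv (UNIV, \<lambda>x. x) = (\<lambda>x::'e. x)" by (auto simp: cinv_def intro!: inv_into_f_eq)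
  then show ?thesis
    by (auto simp: smooth_atlas_def euclidean_atlas_def intro: smooth_near_ident)
qed

lemma smooth_map_euclidean_chart:
  assumes "smooth_atlas A" "smooth_map A euclidean_atlas F" "c \<in> A" "p \<in> cdom c"
  shows "smooth_near UNIV (\<lambda>x. F (cinv c x)) (coords c p)"
  using smooth_map_charts(1)[OF assms(1) smooth_atlas_euclidean assms(2-4), of "(UNIV, \<lambda>x. x)"]
  by (simp add: euclidean_atlas_def)

abbreviation product_chart :: "('m, 'e) chart \<Rightarrow> ('n, 'f) chart \<Rightarrow> ('m \<times> 'n, 'e \<times> 'f) chart" where
  "product_chart c c' \<equiv> (cdom c \<times> cdom c', map_prod (coords c) (coords c'))"

lemma cinv_product_chart:
  assumes "smooth_atlas A" "smooth_atlas B" "c \<in> A" "c' \<in> B" "p \<in> cdom c" "q \<in> cdom c'"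
  shows "cinv (product_chart c c') (coords c p, coords c' q) = (p, q)"
  unfolding cinv_def using assms
  by (intro inv_into_f_eq) (auto simp: smooth_atlas_def intro!: map_prod_inj_on)

lemma eventually_cinv_product:
  assumes "smooth_atlas A" "smooth_atlas B" "c \<in> A" "c' \<in> B" "p \<in> cdom c" "q \<in> cdom c'"
  shows "\<forall>\<^sub>F z in nhds (coords c p, coords c' q). cinv (product_chart c c') z = (cinv c (fst z), cinv c' (snd z))"
  using eventually_nhds_fst[OF eventually_cinv[OF assms(1,3,3,5,5)], of "coords c' q"]
    eventually_nhds_snd[OF eventually_cinv[OF assms(2,4,4,6,6)], of "coords c p"]
proof eventually_elim
  case (elim z)
  with cinv_product_chart[OF assms(1-4), of "cinv c (fst z)" "cinv c' (snd z)"] show ?case by simp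
qed

lemma smooth_atlas_product:
  assumes A: "smooth_atlas A" and B: "smooth_atlas B" shows "smooth_atlas (product_atlas A B)"
  unfolding smooth_atlas_def
proof (intro conjI ballI)
  have in_prod: "\<exists>c c'. c \<in> A \<and> c' \<in> B \<and> C = product_chart c c'" if "C \<in> product_atlas A B" for C
  proof -
    from that obtain z where "z \<in> A \<times> B" "C = (case z of (c, c') \<Rightarrow> product_chart c c')"
      unfolding product_atlas_def by blast
    then show ?thesis by (intro exI[of _ "fst z"] exI[of _ "snd z"]) (auto simp: case_prod_beta)
  qed
  show "inj_on (coords C) (cdom C)" if "C \<in> product_atlas A B" for C
  proof -
    from in_prod[OF that] obtain c c' where c: "c \<in> A" "c' \<in> B" "C = product_chart c c'" by blast
    then have "inj_on (coords c) (cdom c)" "inj_on (coords c') (cdom c')"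
      using A B unfolding smooth_atlas_def by blast+
    then show ?thesis by (simp add: c(3) map_prod_inj_on)
  qed
  fix C C' assume "C \<in> product_atlas A B" "C' \<in> product_atlas A B"
  then obtain a b a' b' where c: "a \<in> A" "b \<in> B" "C = product_chart a b" "a' \<in> A" "b' \<in> B" "C' = product_chart a' b'"
    using in_prod by metis
  have "coords C ` (cdom C \<inter> cdom C') = coords a ` (cdom a \<inter> cdom a') \<times> coords b ` (cdom b \<inter> cdom b')"
    by (auto simp: c)
  moreover have "open (coords a ` (cdom a \<inter> cdom a'))" "open (coords b ` (cdom b \<inter> cdom b'))"
    using A B c unfolding smooth_atlas_def by blast+
  ultimately show "open (coords C ` (cdom C \<inter> cdom C'))" by (simp add: open_Times)
  fix P assume "P \<in> cdom C \<inter> cdom C'"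
  then obtain p q where p: "P = (p, q)" "p \<in> cdom a" "p \<in> cdom a'" "q \<in> cdom b" "q \<in> cdom b'" by (auto simp: c)
  have "smooth_near UNIV (\<lambda>z. (coords a' (cinv a (fst z)), coords b' (cinv b (snd z)))) (coords a p, coords b q)"
    using smooth_near_transition[OF A c(1,4) p(2,3)] smooth_near_transition[OF B c(2,5) p(4,5)]
    by (intro smooth_near_Pair smooth_near_compose[of "\<lambda>x. coords a' (cinv a x)" fst]
       smooth_near_compose[of "\<lambda>x. coords b' (cinv b x)" snd] smooth_near_fst smooth_near_snd smooth_near_ident UNIV_I) simp_all
  then have "smooth_near UNIV (\<lambda>z. coords C' (cinv C z)) (coords a p, coords b q)"
    by (rule smooth_near_cong)
      (use eventually_cinv_product[OF A B c(1,2) p(2,4)] in \<open>auto simp: c elim!: eventually_mono\<close>)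
  then show "smooth_near UNIV (\<lambda>x. coords C' (cinv C x)) (coords C P)" by (simp add: c p)
qed

lemma smooth_map_product_charts:
  assumes A: "smooth_atlas A" and B: "smooth_atlas B" and C: "smooth_atlas C"
    and F: "smooth_map (product_atlas A B) C F"
    and c: "a \<in> A" "p \<in> cdom a" "b \<in> B" "q \<in> cdom b" "c \<in> C" "F (p, q) \<in> cdom c"
  shows "smooth_near UNIV (\<lambda>z. coords c (F (cinv a (fst z), cinv b (snd z)))) (coords a p, coords b q)"
    and "\<forall>\<^sub>F z in nhds (coords a p, coords b q). F (cinv a (fst z), cinv b (snd z)) \<in> cdom c"
proof -
  have P: "product_chart a b \<in> product_atlas A B" "(p, q) \<in> cdom (product_chart a b)"
    using c by (auto simp: product_atlas_def intro!: image_eqI[of _ _ "(a, b)"])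
  note * = smooth_map_charts[OF smooth_atlas_product[OF A B] C F P c(5,6)]
  note ev = eventually_cinv_product[OF A B c(1,3,2,4)]
  have "coords (product_chart a b) (p, q) = (coords a p, coords b q)" by simp
  with * have **: "smooth_near UNIV (\<lambda>x. coords c (F (cinv (product_chart a b) x))) (coords a p, coords b q)"
    "\<forall>\<^sub>F x in nhds (coords a p, coords b q). F (cinv (product_chart a b) x) \<in> cdom c" by metis+
  show "smooth_near UNIV (\<lambda>z. coords c (F (cinv a (fst z), cinv b (snd z)))) (coords a p, coords b q)"
    using **(1) by (rule smooth_near_cong) (use ev in \<open>auto elim!: eventually_mono\<close>)
  show "\<forall>\<^sub>F z in nhds (coords a p, coords b q). F (cinv a (fst z), cinv b (snd z)) \<in> cdom c"
    using **(2) ev by eventually_elim simp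
qed

section \<open>Variations in a chart\<close>

text \<open>The representation of the lift uses the chart assigned to \<open>q t\<close>, which may jump with \<open>t\<close>; in a
  fixed chart the lift is position and velocity.\<close>

lemma tangent_lift_coords:
  fixes q :: "real \<Rightarrow> 'm" and A :: "('m, 'e::euclidean_space) chart set"
  assumes A: "smooth_atlas A" "c \<in> A" "q t \<in> cdom c" and t: "t0 < t1" "t \<in> {t0..t1}"
    and near: "\<forall>\<^sub>F s in nhds t. s \<in> {t0..t1} \<longrightarrow> q s \<in> cdom c"
    and x': "((\<lambda>s. coords c (q s)) has_vector_derivative x') (at t within {t0..t1})"
  shows "coords (tangent_chart A c) (tangent_lift A {t0..t1} q t) = (coords c (q t), x')"
proof -
  let ?c0 = "chart_at A (q t)"
  note c0 = chart_at[OF A(2,3)]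
  note td = transition_has_derivative[OF A(1,2) c0(1) A(3) c0(2)]
  have *: "((\<lambda>s. coords ?c0 (cinv c (coords c (q s)))) has_vector_derivative transition_deriv c ?c0 (q t) x')
      (at t within {t0..t1})"
    using vector_derivative_diff_chain_within[OF x' has_derivative_at_withinI[OF td]] by (simp add: o_def)
  have "(coords ?c0 \<circ> q has_vector_derivative transition_deriv c ?c0 (q t) x') (at t within {t0..t1})"
    using * unfolding has_vector_derivative_def
  proof (rule has_derivative_transform_eventually)
    show "\<forall>\<^sub>F s in at t within {t0..t1}. coords ?c0 (cinv c (coords c (q s))) = (coords ?c0 \<circ> q) s"
      using near cinv_coords[OF A(1,2)] by (auto simp: eventually_at_filter elim: eventually_mono)
  qed (use t A cinv_coords[OF A] in auto)
  from vector_derivative_within_closed_interval[OF t this] show ?thesis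
    by (simp add: tangent_lift_def o_def coords_tangent_chart_surj[OF A])
qed

lemma differential_coords:
  assumes A: "smooth_atlas A" "c \<in> A" "p \<in> cdom c"
    and f: "((\<lambda>x. f (cinv c x)) has_derivative D) (at (coords c p))"
  shows "differential A f p v = D (snd (coords (tangent_chart A c) (p, v)))"
  using frechet_derivative_eqI[OF has_derivative_change_chart[OF A(1) chart_at(1)[OF A(2,3)] A(2) chart_at(2)[OF A(2,3)] A(3) f]]
  by (simp add: differential_def o_def coords_tangent_chart)

text \<open>The flip exchanges the velocity of the base curve with the generator, so in the chart the
  variation of \<open>(x, x')\<close> generated by \<open>y\<close> is \<open>(y, y')\<close>, the variation of a curve with
  \<open>\<delta>x = y\<close>.\<close>

lemma variation_coords:
  fixes q :: "real \<Rightarrow> 'm" and A :: "('m, 'e::euclidean_space) chart set"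
  defines "c \<equiv> \<lambda>t. chart_at A (q t)"
  assumes A: "smooth_atlas A" "c t \<in> A" "q t \<in> cdom (c t)" and t: "t0 < t1" "t \<in> {t0..t1}"
    and near: "\<forall>\<^sub>F s in nhds t. s \<in> {t0..t1} \<longrightarrow> q s \<in> cdom (c t)"
    and \<zeta>: "\<And>s. fst (\<zeta> s) = q s"
    and y': "((\<lambda>s. coords (tangent_chart A (c t)) (\<zeta> s)) has_vector_derivative (x', y')) (at t within {t0..t1})"
    and K: "((\<lambda>z. K (cinv (tangent_chart A (c t)) z)) has_derivative \<kappa>) (at (coords (c t) (q t), x'))"
  shows "differential (tangent_atlas A) K (tangent_lift A {t0..t1} q t) (snd (variation A t0 t1 \<zeta> t))
    = \<kappa> (snd (coords (tangent_chart A (c t)) (\<zeta> t)), y')"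
proof -
  let ?C = "tangent_chart A (c t)" let ?TA = "tangent_atlas A"
  let ?CC = "tangent_chart ?TA ?C"
  note TA = smooth_atlas_tangent[OF A(1)] and C = tangent_chart_in[OF A(2)]
  define \<gamma> where "\<gamma> = tangent_lift A {t0..t1} q t"
  have fstC: "fst (coords ?C z) = coords (c t) (fst z)" for z
    using coords_tangent_chart[of A "c t" "fst z" "snd z"] by simp
  have "((\<lambda>s. fst (coords ?C (\<zeta> s))) has_vector_derivative fst (x', y')) (at t within {t0..t1})"
    using bounded_linear.has_vector_derivative[OF bounded_linear_fst y'] .
  then have "((\<lambda>s. coords (c t) (q s)) has_vector_derivative x') (at t within {t0..t1})"
    by (simp add: fstC \<zeta>)
  from tangent_lift_coords[OF A t near this]
  have \<gamma>: "coords ?C \<gamma> = (coords (c t) (q t), x')" by (simp add: \<gamma>_def)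
  have dom\<gamma>: "\<gamma> \<in> cdom ?C" "fst \<gamma> = q t" using A by (auto simp: \<gamma>_def tangent_lift_def cdom_tangent_chart)
  have dom: "\<zeta> s \<in> cdom ?C \<longleftrightarrow> q s \<in> cdom (c t)" for s
    using \<zeta>[of s] by (simp add: cdom_tangent_chart mem_Times_iff)
  have "coords ?CC (tangent_lift ?TA {t0..t1} \<zeta> t) = (coords ?C (\<zeta> t), (x', y'))"
    using A near by (intro tangent_lift_coords[OF TA C _ t _ y']) (simp_all add: dom)
  moreover have "fst (fst (tangent_lift ?TA {t0..t1} \<zeta> t)) = q t" by (simp add: tangent_lift_def \<zeta>)
  ultimately have "variation A t0 t1 \<zeta> t
      = cinv ?CC ((coords (c t) (q t), x'), (snd (coords ?C (\<zeta> t)), y'))"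
    using fstC[of "\<zeta> t"] unfolding variation_def canonical_flip_def Let_def
    by (cases "coords ?C (\<zeta> t)") (simp add: \<zeta> c_def)
  also have "\<dots> = cinv ?CC (coords ?C \<gamma>, (snd (coords ?C (\<zeta> t)), y'))" by (simp add: \<gamma>)
  also have "\<dots> = (\<gamma>, transition_deriv ?C (chart_at ?TA \<gamma>) \<gamma> (snd (coords ?C (\<zeta> t)), y'))"
    using cinv_tangent_chart[OF TA C dom\<gamma>(1)] .
  finally have v: "variation A t0 t1 \<zeta> t = \<dots>" .
  have "differential ?TA K \<gamma> (snd (variation A t0 t1 \<zeta> t)) = \<kappa> (snd (coords ?CC (\<gamma>, snd (variation A t0 t1 \<zeta> t))))"
    using K by (intro differential_coords[OF TA C dom\<gamma>(1)]) (simp add: \<gamma>)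
  then show ?thesis unfolding v \<gamma>_def[symmetric] by (simp add: coords_tangent_chart_surj[OF TA C dom\<gamma>(1)])
qed

lemma smooth_curve_charts:
  assumes A: "smooth_atlas A" "c \<in> A" "q t \<in> cdom c" and q: "smooth_curve A I q" "t \<in> I"
  shows "smooth_near I (\<lambda>s. coords c (q s)) t"
    and "\<forall>\<^sub>F s in nhds t. s \<in> I \<longrightarrow> q s \<in> cdom c"
proof -
  from q obtain c1 J where c1: "c1 \<in> A" "open J" "t \<in> J" "q ` (I \<inter> J) \<subseteq> cdom c1"
    "smooth_on (I \<inter> J) (coords c1 \<circ> q)" unfolding smooth_curve_def by blast
  let ?f = "\<lambda>s. coords c1 (q s)"
  have f: "smooth_near I ?f t" using q(2) c1 by (intro smooth_nearI[of _ _ J]) (auto simp: o_def)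
  have qt: "q t \<in> cdom c1" using c1 q by auto
  have J: "\<forall>\<^sub>F s in nhds t. s \<in> J" using c1 by (intro eventually_nhds_in_open)
  have "open (coords c1 ` (cdom c1 \<inter> cdom c))" using A c1 unfolding smooth_atlas_def by blast
  then have "\<forall>\<^sub>F x in nhds (?f t). x \<in> coords c1 ` (cdom c1 \<inter> cdom c)"
    using A(3) qt by (intro eventually_nhds_in_open) auto
  then have "\<forall>\<^sub>F s in at t within I. ?f s \<in> coords c1 ` (cdom c1 \<inter> cdom c)"
    using smooth_near_continuous[OF f] unfolding continuous_within by (rule eventually_compose_filterlim)
  then have "\<forall>\<^sub>F s in nhds t. s \<noteq> t \<longrightarrow> s \<in> I \<longrightarrow> ?f s \<in> coords c1 ` (cdom c1 \<inter> cdom c)"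
    by (simp add: eventually_at_filter)
  then show ev: "\<forall>\<^sub>F s in nhds t. s \<in> I \<longrightarrow> q s \<in> cdom c" using J
  proof eventually_elim
    case (elim s)
    show ?case
    proof
      assume s: "s \<in> I"
      show "q s \<in> cdom c"
      proof (cases "s = t")
        case False
        then obtain p where p: "p \<in> cdom c1" "p \<in> cdom c" "?f s = coords c1 p" using elim s by auto
        moreover have "q s \<in> cdom c1" using elim s c1(4) by auto
        ultimately have "q s = p" using A(1) c1(1) unfolding smooth_atlas_def by (auto dest: inj_onD)
        then show ?thesis using p by simp
      qed (use A in simp)
    qed
  qed
  have "smooth_near I (\<lambda>s. coords c (cinv c1 (?f s))) t"
    using smooth_near_compose[of "\<lambda>x. coords c (cinv c1 x)", OF smooth_near_transition[OF A(1) c1(1) A(2) qt A(3)] f] .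
  then show "smooth_near I (\<lambda>s. coords c (q s)) t"
    by (rule smooth_near_cong) (use J in \<open>eventually_elim, use c1(4) cinv_coords[OF A(1) c1(1)] in force\<close>)
qed

section \<open>Left translations in charts\<close>

locale lie = group G for G :: "('h, 'e::euclidean_space) lie_structure" (structure) +
  assumes lie: "lie_group G"
begin

abbreviation "A \<equiv> atlas G"
abbreviation "TA \<equiv> tangent_atlas (atlas G)"
abbreviation "c1 \<equiv> chart_at (atlas G) \<one>"
abbreviation "x1 \<equiv> coords (chart_at (atlas G) \<one>) \<one>"

lemma atlas: "smooth_atlas A"
  using lie unfolding lie_group_def by (blast intro: smooth_manifold_imp_smooth_atlas)

lemma points_atlas: "points A = carrier G" using lie unfolding lie_group_def by blast

lemma cdom_carrier: "c \<in> A \<Longrightarrow> p \<in> cdom c \<Longrightarrow> p \<in> carrier G"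
  using points_atlas by (auto simp: points_def)

lemma chart_at_carrier:
  assumes "p \<in> carrier G" shows "chart_at A p \<in> A" "p \<in> cdom (chart_at A p)"
proof -
  from assms have "p \<in> points A" by (simp add: points_atlas)
  then obtain c where "c \<in> A" "p \<in> cdom c" unfolding points_def by blast
  then show "chart_at A p \<in> A" "p \<in> cdom (chart_at A p)" by (rule chart_at)+
qed

lemmas c1 = chart_at_carrier[OF one_closed]

lemma mult_charts:
  assumes "a \<in> A" "p \<in> cdom a" "b \<in> A" "q \<in> cdom b" "c \<in> A" "p \<otimes> q \<in> cdom c"
  shows "smooth_near UNIV (\<lambda>z. coords c (cinv a (fst z) \<otimes> cinv b (snd z))) (coords a p, coords b q)"
    and "\<forall>\<^sub>F z in nhds (coords a p, coords b q). cinv a (fst z) \<otimes> cinv b (snd z) \<in> cdom c"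
  using smooth_map_product_charts[OF atlas atlas atlas, of "\<lambda>(x, y). x \<otimes> y" a p b q c] assms lie
  unfolding lie_group_def by auto

lemma translation_charts:
  assumes "p \<in> carrier G" "b \<in> A" "q \<in> cdom b" "c \<in> A" "p \<otimes> q \<in> cdom c"
  shows "smooth_near UNIV (\<lambda>u. coords c (p \<otimes> cinv b u)) (coords b q)"
    and "\<forall>\<^sub>F u in nhds (coords b q). p \<otimes> cinv b u \<in> cdom c"
proof -
  let ?a = "chart_at A p" note a = chart_at_carrier[OF assms(1)]
  note m = mult_charts[OF a assms(2-)]
  have i: "smooth_near UNIV (\<lambda>u. (coords ?a p, u)) (coords b q)"
    by (intro smooth_near_Pair smooth_near_const smooth_near_ident UNIV_I)
  show "smooth_near UNIV (\<lambda>u. coords c (p \<otimes> cinv b u)) (coords b q)"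
    using smooth_near_compose[OF m(1) i] by (simp add: cinv_coords[OF atlas a])
  show "\<forall>\<^sub>F u in nhds (coords b q). p \<otimes> cinv b u \<in> cdom c"
    using smooth_near_eventually_image[OF i m(2)] by (simp add: cinv_coords[OF atlas a])
qed

text \<open>\<open>frame c x v\<close> are the components in the chart \<open>c\<close> of the left-invariant vector field that
  takes the value \<open>v\<close> at the unit.\<close>

definition frame :: "('h, 'e) chart \<Rightarrow> 'e \<Rightarrow> 'e \<Rightarrow> 'e" where
  "frame c x v = vf_coords A c (\<lambda>h. push G h v) x"

lemma push_eq:
  assumes "p \<in> carrier G"
  shows "push G p v = frechet_derivative (\<lambda>u. coords (chart_at A p) (p \<otimes> cinv c1 u)) (at x1) v"
  using assms by (simp add: push_def tangent_map_def o_def)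

lemma frame_push:
  assumes c: "c \<in> A" "p \<in> cdom c"
  shows "frame c (coords c p) v = transition_deriv (chart_at A p) c p (push G p v)"
  by (simp add: frame_def vf_coords_def cinv_coords[OF atlas c] coords_tangent_chart)

lemma frame_eq:
  assumes c: "c \<in> A" "p \<in> cdom c"
  shows "frame c (coords c p) v = frechet_derivative (\<lambda>u. coords c (p \<otimes> cinv c1 u)) (at x1) v"
proof -
  have p: "p \<in> carrier G" using c by (rule cdom_carrier)
  let ?c0 = "chart_at A p" note c0 = chart_at_carrier[OF p]
  let ?f = "\<lambda>u. coords ?c0 (p \<otimes> cinv c1 u)"
  have 1: "smooth_near UNIV ?f x1" "\<forall>\<^sub>F u in nhds x1. p \<otimes> cinv c1 u \<in> cdom ?c0"
    using translation_charts[OF p c1 c0(1)] c0 p by auto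
  have "((\<lambda>u. coords c (cinv ?c0 (?f u))) has_derivative (\<lambda>v. transition_deriv ?c0 c p (push G p v))) (at x1)"
    using diff_chain_at[OF smooth_near_has_derivative[OF 1(1)], of "\<lambda>x. coords c (cinv ?c0 x)" "transition_deriv ?c0 c p"]
      transition_has_derivative[OF atlas c0(1) c(1) c0(2) c(2)] p
    by (simp add: o_def cinv_coords[OF atlas c1] push_eq)
  then have "((\<lambda>u. coords c (p \<otimes> cinv c1 u)) has_derivative (\<lambda>v. transition_deriv ?c0 c p (push G p v))) (at x1)"
    by (rule has_derivative_transform_nhds)
      (use 1(2) in eventually_elim, simp add: cinv_coords[OF atlas c0(1)])
  from frechet_derivative_eqI[OF this] show ?thesis by (simp add: frame_push[OF c])
qed

lemma frame_smooth:
  assumes c: "c \<in> A" "p \<in> cdom c"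
  shows "smooth_near UNIV (\<lambda>z. frame c (fst z) (snd z)) (coords c p, v)"
proof (rule smooth_near_cong)
  have p: "p \<in> carrier G" using c by (rule cdom_carrier)
  have "smooth_near UNIV (\<lambda>z. coords c (cinv c (fst z) \<otimes> cinv c1 (snd z))) (coords c p, x1)"
    using mult_charts(1)[OF c c1 c(1)] c p by simp
  then have *: "smooth_near UNIV (\<lambda>z. coords c (cinv c (fst z) \<otimes> cinv c1 (snd z))) (fst (coords c p, v), x1)"
    by simp
  show "smooth_near UNIV (\<lambda>z. frechet_derivative (\<lambda>u. coords c (cinv c (fst z) \<otimes> cinv c1 u)) (at x1) (snd z)) (coords c p, v)"
  proof -
    let ?f = "\<lambda>z. coords c (cinv c (fst z) \<otimes> cinv c1 (snd z))"
    have "smooth_near UNIV (\<lambda>y. frechet_derivative (\<lambda>w. ?f (fst y, w)) (at ((\<lambda>_. x1) y)) (snd y)) (coords c p, v)"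
      using * by (intro smooth_near_partial2[of ?f fst _ "(\<lambda>_. x1)"] smooth_near_fst smooth_near_snd
          smooth_near_ident smooth_near_const UNIV_I)
    then show ?thesis by simp
  qed
  show "\<forall>\<^sub>F z in nhds (coords c p, v). z \<in> UNIV \<longrightarrow> frame c (fst z) (snd z)
      = frechet_derivative (\<lambda>u. coords c (cinv c (fst z) \<otimes> cinv c1 u)) (at x1) (snd z)"
    using eventually_nhds_fst[OF eventually_cinv[OF atlas c(1,1,2,2)]]
  proof eventually_elim
    case (elim z)
    then show ?case using frame_eq[of c "cinv c (fst z)" "snd z"] c by simp
  qed
qed

lemma linear_frame:
  assumes c: "c \<in> A" "p \<in> cdom c" shows "linear (frame c (coords c p))"
proof -
  have p: "p \<in> carrier G" using c by (rule cdom_carrier)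
  have "smooth_near UNIV (\<lambda>u. coords c (p \<otimes> cinv c1 u)) x1"
    using translation_charts(1)[OF p c1 c(1)] c p by simp
  then have "linear (frechet_derivative (\<lambda>u. coords c (p \<otimes> cinv c1 u)) (at x1))"
    by (intro linear_frechet_derivative smooth_near_differentiable)
  then show ?thesis by (simp add: frame_eq[OF c, abs_def])
qed

lemma coords_left_triv:
  assumes c: "c \<in> A" "p \<in> cdom c"
  shows "coords (tangent_chart A c) (left_triv G (p, v)) = (coords c p, frame c (coords c p) v)"
  by (simp add: left_triv_def coords_tangent_chart frame_push[OF c])

text \<open>The inverse of \<open>frame c x\<close>. Writing it as a derivative of the translation by the inverse makes
  its smooth dependence on \<open>x\<close> a consequence of the smoothness of product and inversion.\<close>

definition coframe :: "('h, 'e) chart \<Rightarrow> 'e \<Rightarrow> 'e \<Rightarrow> 'e" where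
  "coframe c x v = frechet_derivative (\<lambda>u. coords c1 (inv (cinv c x) \<otimes> cinv c u)) (at x) v"

lemma coframe_frame:
  assumes c: "c \<in> A" "p \<in> cdom c"
  shows "coframe c (coords c p) (frame c (coords c p) v) = v"
proof -
  have p: "p \<in> carrier G" using c by (rule cdom_carrier)
  have 1: "smooth_near UNIV (\<lambda>u. coords c (p \<otimes> cinv c1 u)) x1" "\<forall>\<^sub>F u in nhds x1. p \<otimes> cinv c1 u \<in> cdom c"
    using translation_charts[OF p c1 c(1)] c p by auto
  have 2: "smooth_near UNIV (\<lambda>u. coords c1 (inv p \<otimes> cinv c u)) (coords c p)"
    using translation_charts(1)[OF _ c c1(1), of "inv p"] c1 p by simp
  have "((\<lambda>u. coords c1 (inv p \<otimes> cinv c (coords c (p \<otimes> cinv c1 u)))) has_derivative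
      (\<lambda>v. coframe c (coords c p) (frame c (coords c p) v))) (at x1)"
    using diff_chain_at[OF smooth_near_has_derivative[OF 1(1)], of "\<lambda>u. coords c1 (inv p \<otimes> cinv c u)"]
      smooth_near_has_derivative[OF 2] p
    by (simp add: o_def cinv_coords[OF atlas c1] cinv_coords[OF atlas c] coframe_def frame_eq[OF c])
  then have "((\<lambda>u. u) has_derivative (\<lambda>v. coframe c (coords c p) (frame c (coords c p) v))) (at x1)"
  proof (rule has_derivative_transform_nhds)
    show "\<forall>\<^sub>F u in nhds x1. u = coords c1 (inv p \<otimes> cinv c (coords c (p \<otimes> cinv c1 u)))"
      using 1(2) eventually_cinv[OF atlas c1(1,1,2,2)]
    proof eventually_elim
      case (elim u)
      then have "cinv c1 u \<in> carrier G" using cdom_carrier c1 by blast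
      then have "inv p \<otimes> (p \<otimes> cinv c1 u) = cinv c1 u" using p by (simp flip: m_assoc)
      then show ?case using elim by (simp add: cinv_coords[OF atlas c(1)])
    qed
  qed
  from has_derivative_unique[OF this has_derivative_ident] show ?thesis by metis
qed

lemma frame_coframe:
  assumes c: "c \<in> A" "p \<in> cdom c"
  shows "frame c (coords c p) (coframe c (coords c p) v) = v"
proof -
  have "inj (frame c (coords c p))" using coframe_frame[OF c] by (metis injI)
  then have "surj (frame c (coords c p))" using linear_frame[OF c] linear_injective_imp_surjective by blast
  then obtain w where "v = frame c (coords c p) w" by auto
  then show ?thesis using coframe_frame[OF c] by simp
qed

lemma coframe_smooth:
  assumes c: "c \<in> A" "p \<in> cdom c"
  shows "smooth_near UNIV (\<lambda>z. coframe c (fst z) (snd z)) (coords c p, v)"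
proof -
  have p: "p \<in> carrier G" using c by (rule cdom_carrier)
  then have ip: "inv p \<in> carrier G" by simp
  let ?i = "chart_at A (inv p)" note i = chart_at_carrier[OF ip]
  have "smooth_map A A (\<lambda>x. inv x)" using lie unfolding lie_group_def by blast
  note inv = smooth_map_charts[OF atlas atlas this c i]
  have "smooth_near UNIV (\<lambda>z. (coords ?i (inv (cinv c (fst z))), snd z)) (coords c p, coords c p)"
    using inv(1) by (intro smooth_near_Pair smooth_near_compose[of "\<lambda>x. coords ?i (inv (cinv c x))" fst]
        smooth_near_fst smooth_near_snd smooth_near_ident UNIV_I) simp
  moreover have "smooth_near UNIV (\<lambda>z. coords c1 (cinv ?i (fst z) \<otimes> cinv c (snd z)))
      (coords ?i (inv (cinv c (fst (coords c p, coords c p)))), snd (coords c p, coords c p))"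
    using mult_charts(1)[OF i c c1(1)] c1 p by (simp add: cinv_coords[OF atlas c])
  ultimately have "smooth_near UNIV (\<lambda>z. coords c1 (cinv ?i (coords ?i (inv (cinv c (fst z)))) \<otimes> cinv c (snd z))) (coords c p, coords c p)"
    using smooth_near_compose[of "\<lambda>z. coords c1 (cinv ?i (fst z) \<otimes> cinv c (snd z))"
        "\<lambda>z. (coords ?i (inv (cinv c (fst z))), snd z)" "(coords c p, coords c p)" UNIV] by simp
  then have "smooth_near UNIV (\<lambda>z. coords c1 (inv (cinv c (fst z)) \<otimes> cinv c (snd z))) (coords c p, coords c p)"
    by (rule smooth_near_cong)
      (use eventually_nhds_fst[OF inv(2)] in eventually_elim, simp add: cinv_coords[OF atlas i(1)])
  then have *: "smooth_near UNIV (\<lambda>z. coords c1 (inv (cinv c (fst z)) \<otimes> cinv c (snd z))) (fst (coords c p, v), fst (coords c p, v))"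
    by simp
  show ?thesis
  proof -
    let ?f = "\<lambda>z. coords c1 (inv (cinv c (fst z)) \<otimes> cinv c (snd z))"
    have "smooth_near UNIV (\<lambda>y. frechet_derivative (\<lambda>w. ?f (fst y, w)) (at (fst y)) (snd y)) (coords c p, v)"
      using * by (intro smooth_near_partial2[of ?f fst _ "fst"] smooth_near_fst smooth_near_snd
          smooth_near_ident smooth_near_const UNIV_I)
    then show ?thesis by (simp add: coframe_def)
  qed
qed

lemma left_triv_inv:
  assumes p: "p \<in> carrier G" shows "left_triv_inv G (left_triv G (p, v)) = (p, v)"
  unfolding left_triv_inv_def
proof (rule inv_into_f_f)
  show "inj_on (left_triv G) (carrier G \<times> UNIV)"
  proof (rule inj_onI, clarsimp simp: left_triv_def)
    fix q v w assume q: "q \<in> carrier G" and eq: "push G q v = push G q w"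
    let ?c = "chart_at A q" note c = chart_at_carrier[OF q]
    have "frame ?c (coords ?c q) v = frame ?c (coords ?c q) w"
      by (simp add: frame_push[OF c] eq)
    then show "v = w" using coframe_frame[OF c] by metis
  qed
qed (use p in simp)

end

section \<open>The bracket of left-invariant fields\<close>

lemma (in lie) frame_field_smooth:
  assumes c: "c \<in> A" "p \<in> cdom c"
  shows "smooth_near UNIV (\<lambda>x. frame c x v) (coords c p)"
  using smooth_near_compose[of "\<lambda>z. frame c (fst z) (snd z)" "\<lambda>x. (x, v)", OF _
      smooth_near_Pair[OF smooth_near_ident[OF UNIV_I] smooth_near_const[OF UNIV_I]], of "coords c p"]
    frame_smooth[OF c] by simp

lemma (in lie) push_frame:
  assumes "p \<in> carrier G" shows "push G p v = frame (chart_at A p) (coords (chart_at A p) p) v"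
  using transition_deriv_refl[OF atlas chart_at_carrier[OF assms]]
  by (simp add: frame_push[OF chart_at_carrier[OF assms]])

lemma (in lie) frame_one: "frame c1 x1 v = v"
proof -
  have "frame c1 x1 v = frechet_derivative (\<lambda>u. coords c1 (\<one> \<otimes> cinv c1 u)) (at x1) v"
    by (rule frame_eq[OF c1])
  also have "((\<lambda>u. coords c1 (\<one> \<otimes> cinv c1 u)) has_derivative (\<lambda>v. v)) (at x1)"
    by (rule has_derivative_transform_nhds[OF has_derivative_ident])
      (use eventually_cinv[OF atlas c1(1,1,2,2)] in eventually_elim, use cdom_carrier c1 in \<open>metis l_one\<close>)
  then have "frechet_derivative (\<lambda>u. coords c1 (\<one> \<otimes> cinv c1 u)) (at x1) v = v"
    by (rule frechet_derivative_eqI)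
  finally show ?thesis .
qed

lemma (in lie) left_bracket_frame:
  "left_bracket G a b = frechet_derivative (\<lambda>x. frame c1 x b) (at x1) a
    - frechet_derivative (\<lambda>x. frame c1 x a) (at x1) b"
  by (simp add: left_bracket_def vf_bracket_def Let_def frame_def[symmetric, abs_def] frame_one)

text \<open>Left translation by \<open>p\<close> maps every left-invariant field to itself; this is associativity
  of the product.\<close>

lemma (in lie) frame_translation_related:
  assumes c: "c \<in> A" "p \<in> cdom c"
  shows "\<forall>\<^sub>F u in nhds x1. frame c (coords c (p \<otimes> cinv c1 u)) a
    = frechet_derivative (\<lambda>u. coords c (p \<otimes> cinv c1 u)) (at u) (frame c1 u a)"
proof -
  have p: "p \<in> carrier G" using c by (rule cdom_carrier)
  define lam where "lam u = coords c (p \<otimes> cinv c1 u)" for u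
  have 1: "smooth_near UNIV lam x1" "\<forall>\<^sub>F u in nhds x1. p \<otimes> cinv c1 u \<in> cdom c"
    using translation_charts[OF p c1 c(1)] c p unfolding lam_def by auto
  have "\<forall>\<^sub>F u in nhds x1. smooth_near UNIV lam u" using smooth_near_eventually[OF 1(1)] by simp
  then show ?thesis using 1(2) eventually_cinv[OF atlas c1(1,1,2,2)]
  proof eventually_elim
    case (elim u)
    define g where "g = cinv c1 u"
    have g: "g \<in> cdom c1" "coords c1 g = u" "p \<otimes> g \<in> cdom c" using elim by (auto simp: g_def)
    have gc: "g \<in> carrier G" using g c1 cdom_carrier by blast
    define T where "T w = coords c1 (g \<otimes> cinv c1 w)" for w
    have T: "smooth_near UNIV T x1" "\<forall>\<^sub>F w in nhds x1. g \<otimes> cinv c1 w \<in> cdom c1"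
      using translation_charts[OF gc c1 c1(1)] g gc unfolding T_def by auto
    have Tx: "T x1 = u" using g gc by (simp add: T_def cinv_coords[OF atlas c1])
    have E: "frame c1 u v = frechet_derivative T (at x1) v" for v
      using frame_eq[OF c1(1) g(1)] by (simp add: T_def[abs_def] g(2))
    have "((\<lambda>w. lam (T w)) has_derivative (\<lambda>v. frechet_derivative lam (at u) (frame c1 u v))) (at x1)"
      using diff_chain_at[OF smooth_near_has_derivative[OF T(1)], of lam "frechet_derivative lam (at u)"]
        smooth_near_has_derivative[OF elim(1)] by (simp add: o_def Tx E)
    then have "((\<lambda>w. coords c (p \<otimes> g \<otimes> cinv c1 w)) has_derivative (\<lambda>v. frechet_derivative lam (at u) (frame c1 u v))) (at x1)"
    proof (rule has_derivative_transform_nhds)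
      show "\<forall>\<^sub>F w in nhds x1. coords c (p \<otimes> g \<otimes> cinv c1 w) = lam (T w)"
        using T(2) eventually_cinv[OF atlas c1(1,1,2,2)]
      proof eventually_elim
        case (elim w)
        then have "cinv c1 w \<in> carrier G" using c1 cdom_carrier by blast
        then show ?case using elim p gc by (simp add: lam_def T_def cinv_coords[OF atlas c1(1)] m_assoc)
      qed
    qed
    from frechet_derivative_eqI[OF this, of a] frame_eq[OF c(1) g(3), of a]
    show ?case by (simp add: lam_def[abs_def] g_def)
  qed
qed

text \<open>The bracket of two left-invariant fields is the left-invariant field of the bracket: in the
  derivative of \<open>frame_translation_related\<close>, the second derivatives of the translation cancel by
  symmetry.\<close>

lemma (in lie) frame_bracket:
  assumes c: "c \<in> A" "p \<in> cdom c"
  defines "x \<equiv> coords c p"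
  shows "frechet_derivative (\<lambda>x. frame c x b) (at x) (frame c x a)
    - frechet_derivative (\<lambda>x. frame c x a) (at x) (frame c x b) = frame c x (left_bracket G a b)"
proof -
  have p: "p \<in> carrier G" using c by (rule cdom_carrier)
  define lam where "lam u = coords c (p \<otimes> cinv c1 u)" for u
  have lam: "smooth_near UNIV lam x1"
    using translation_charts[OF p c1 c(1)] c p unfolding lam_def by auto
  have lamx: "lam x1 = x" using p by (simp add: lam_def x_def cinv_coords[OF atlas c1])
  have Dlam: "frechet_derivative lam (at x1) v = frame c x v" for v
    unfolding x_def frame_eq[OF c] by (simp add: lam_def[abs_def])
  define H where "H a b = frechet_derivative (\<lambda>z. frechet_derivative lam (at z) a) (at x1) b" for a b
  have H: "H a b = H b a" for a b unfolding H_def by (rule second_derivative_symmetric[OF lam])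
  have key: "frechet_derivative (\<lambda>x. frame c x a) (at x) (frame c x b)
     = H a b + frame c x (frechet_derivative (\<lambda>u. frame c1 u a) (at x1) b)" for a b
  proof -
    have F: "smooth_near UNIV (\<lambda>x. frame c x a) (lam x1)"
      unfolding lamx x_def by (rule frame_field_smooth[OF c])
    have "((\<lambda>u. frame c (lam u) a) has_derivative
        (\<lambda>b. frechet_derivative (\<lambda>x. frame c x a) (at x) (frame c x b))) (at x1)"
      using diff_chain_at[OF smooth_near_has_derivative[OF lam] smooth_near_has_derivative[OF F]]
      by (simp add: o_def lamx Dlam)
    moreover have "((\<lambda>u. frame c (lam u) a) has_derivative
        (\<lambda>b. H a b + frame c x (frechet_derivative (\<lambda>u. frame c1 u a) (at x1) b))) (at x1)"
    proof (rule has_derivative_transform_nhds)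
      let ?G = "\<lambda>z. frechet_derivative lam (at (fst z)) (snd z)"
      have G: "smooth_near UNIV ?G (x1, a)"
        using lam by (intro smooth_near_frechet_derivative[of lam fst] smooth_near_fst smooth_near_snd smooth_near_ident UNIV_I) simp
      have E: "((\<lambda>u. (u, frame c1 u a)) has_derivative (\<lambda>b. (b, frechet_derivative (\<lambda>u. frame c1 u a) (at x1) b))) (at x1)"
        using smooth_near_has_derivative[OF frame_field_smooth[OF c1]] by (intro has_derivative_Pair has_derivative_ident)
      have lin: "frechet_derivative (frame c x) (at a) v = frame c x v" for v
        using linear_frame[OF c] unfolding x_def
        by (intro frechet_derivative_eqI) (simp add: linear_imp_has_derivative)
      have "?G differentiable (at (x1, a))" using G by (rule smooth_near_differentiable)
      from frechet_derivative_split[OF this]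
      have GG: "frechet_derivative ?G (at (x1, a)) (b, w) = H a b + frame c x w" for b w
        by (simp add: H_def lin Dlam)
      show "((\<lambda>u. frechet_derivative lam (at u) (frame c1 u a)) has_derivative
        (\<lambda>b. H a b + frame c x (frechet_derivative (\<lambda>u. frame c1 u a) (at x1) b))) (at x1)"
        using diff_chain_at[OF E, of ?G "frechet_derivative ?G (at (x1, a))"] smooth_near_has_derivative[OF G]
        by (simp add: o_def frame_one GG)
      show "\<forall>\<^sub>F u in nhds x1. frame c (lam u) a = frechet_derivative lam (at u) (frame c1 u a)"
        using frame_translation_related[OF c] by (simp add: lam_def[abs_def])
    qed
    ultimately show ?thesis by (rule fun_cong[OF has_derivative_unique])
  qed
  have "linear (frame c x)" unfolding x_def by (rule linear_frame[OF c])
  then show ?thesis unfolding key H[of b a] left_bracket_frame by (simp add: linear_diff)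
qed

lemma (in lie) linear_left_bracket: "linear (left_bracket G a)" "linear (\<lambda>a. left_bracket G a b)"
proof -
  have F: "((\<lambda>x. frame c1 x b) has_derivative frechet_derivative (\<lambda>x. frame c1 x b) (at x1)) (at x1)" for b
    using smooth_near_has_derivative[OF frame_field_smooth[OF c1]] .
  have lin: "\<forall>\<^sub>F x in nhds x1. linear (frame c1 x)"
    using eventually_cinv[OF atlas c1(1,1,2,2)] by eventually_elim (use linear_frame[OF c1(1)] in metis)
  have l1: "linear (\<lambda>b. frechet_derivative (\<lambda>x. frame c1 x b) (at x1) v)" for v
  proof (rule linearI)
    show "frechet_derivative (\<lambda>x. frame c1 x (b + b')) (at x1) v = frechet_derivative (\<lambda>x. frame c1 x b) (at x1) v
      + frechet_derivative (\<lambda>x. frame c1 x b') (at x1) v" for b b'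
      by (rule frechet_derivative_eqI, rule has_derivative_transform_nhds[OF has_derivative_add[OF F F]])
        (use lin in eventually_elim, simp add: linear_add)
    show "frechet_derivative (\<lambda>x. frame c1 x (r *\<^sub>R b)) (at x1) v = r *\<^sub>R frechet_derivative (\<lambda>x. frame c1 x b) (at x1) v" for r b
      by (rule frechet_derivative_eqI, rule has_derivative_transform_nhds[OF has_derivative_scaleR_right[OF F]])
        (use lin in eventually_elim, simp add: linear_scale)
  qed
  have l2: "linear (frechet_derivative (\<lambda>x. frame c1 x b) (at x1))" for b
    using F has_derivative_linear by blast
  show "linear (left_bracket G a)"
    using linear_compose_sub[OF l1[of a] l2[of a]] by (simp add: left_bracket_frame[abs_def])
  show "linear (\<lambda>a. left_bracket G a b)"
    using linear_compose_sub[OF l2[of b] l1[of b]] by (simp add: left_bracket_frame[abs_def])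
qed

section \<open>The first variation\<close>

text \<open>In the chart, \<open>L (g\<^sub>* \<theta>)\<close> is the coordinate Lagrangian at \<open>(x, frame c x \<theta>)\<close>.\<close>

lemma (in lie) trivialized_smooth:
  assumes L: "smooth_map TA euclidean_atlas L" and c: "c \<in> A" "p \<in> cdom c"
  shows "smooth_near UNIV (\<lambda>z. L (left_triv G (cinv c (fst z), snd z))) (coords c p, \<theta>)"
proof (rule smooth_near_cong)
  let ?C = "tangent_chart A c"
  note TA = smooth_atlas_tangent[OF atlas] and C = tangent_chart_in[OF c(1)]
  have dom: "left_triv G (q, v) \<in> cdom ?C \<longleftrightarrow> q \<in> cdom c" for q v
    by (simp add: cdom_tangent_chart left_triv_def)
  have "smooth_near UNIV (\<lambda>z. L (cinv ?C z)) (coords ?C (left_triv G (p, \<theta>)))"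
    using smooth_map_euclidean_chart[OF TA L C] dom c by blast
  then have l: "smooth_near UNIV (\<lambda>z. L (cinv ?C z)) (coords c p, frame c (coords c p) \<theta>)"
    by (simp add: coords_left_triv[OF c])
  have "smooth_near UNIV (\<lambda>z. (fst z, frame c (fst z) (snd z))) (coords c p, \<theta>)"
    using frame_smooth[OF c] by (intro smooth_near_Pair smooth_near_fst smooth_near_ident UNIV_I)
  from smooth_near_compose[of "\<lambda>z. L (cinv ?C z)", OF _ this] l
  show "smooth_near UNIV (\<lambda>z. L (cinv ?C (fst z, frame c (fst z) (snd z)))) (coords c p, \<theta>)" by simp
  show "\<forall>\<^sub>F z in nhds (coords c p, \<theta>). z \<in> UNIV \<longrightarrow> L (left_triv G (cinv c (fst z), snd z)) = L (cinv ?C (fst z, frame c (fst z) (snd z)))"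
    using eventually_nhds_fst[OF eventually_cinv[OF atlas c(1,1,2,2)]]
  proof eventually_elim
    case (elim z)
    then show ?case
      using coords_left_triv[OF c(1), of "cinv c (fst z)" "snd z"] cinv_coords[OF TA C, of "left_triv G (cinv c (fst z), snd z)"] dom
      by simp
  qed
qed

text \<open>The derivative of a function \<open>K\<close> on \<open>TH\<close> in the induced chart, in terms of the trivialized
  function \<open>(g, \<theta>) \<mapsto> K (g\<^sub>* \<theta>)\<close>. A modified Lagrangian is explicit only in
  its trivialized form; the smoothness of \<open>coframe\<close> transports its differentiability to \<open>TH\<close>.\<close>

lemma (in lie) trivialized_derivative:
  fixes K :: "'h \<times> 'e \<Rightarrow> real"
  assumes c: "c \<in> A" "p \<in> cdom c"
  defines "k \<equiv> \<lambda>z. K (left_triv G (cinv c (fst z), snd z))" and "x \<equiv> coords c p"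
  assumes k: "k differentiable (at (x, \<eta>))"
  obtains \<kappa> where "((\<lambda>z. K (cinv (tangent_chart A c) z)) has_derivative \<kappa>) (at (x, frame c x \<eta>))"
    and "\<And>u \<theta>. \<kappa> (u, frechet_derivative (\<lambda>x. frame c x \<eta>) (at x) u + frame c x \<theta>)
      = frechet_derivative (\<lambda>x. k (x, \<eta>)) (at x) u + frechet_derivative (\<lambda>\<theta>. k (x, \<theta>)) (at \<eta>) \<theta>"
proof -
  let ?C = "tangent_chart A c"
  note TA = smooth_atlas_tangent[OF atlas] and C = tangent_chart_in[OF c(1)]
  have triv: "cinv ?C (coords c q, frame c (coords c q) v) = left_triv G (q, v)" if "q \<in> cdom c" for q v
    using coords_left_triv[OF c(1) that, of v] cinv_coords[OF TA C, of "left_triv G (q, v)"] that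
    by (simp add: cdom_tangent_chart left_triv_def)
  let ?\<psi> = "\<lambda>z. (fst z, coframe c (fst z) (snd z))" and ?\<phi> = "\<lambda>z. (fst z, frame c (fst z) (snd z))"
  have \<psi>: "smooth_near UNIV ?\<psi> (x, frame c x \<eta>)" unfolding x_def
    using coframe_smooth[OF c] by (intro smooth_near_Pair smooth_near_fst smooth_near_ident UNIV_I)
  have \<phi>: "smooth_near UNIV ?\<phi> (x, \<eta>)" unfolding x_def
    using frame_smooth[OF c] by (intro smooth_near_Pair smooth_near_fst smooth_near_ident UNIV_I)
  have \<psi>x: "?\<psi> (x, frame c x \<eta>) = (x, \<eta>)" by (simp add: x_def coframe_frame[OF c])
  define \<kappa> where "\<kappa> v = frechet_derivative k (at (x, \<eta>)) (frechet_derivative ?\<psi> (at (x, frame c x \<eta>)) v)" for v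
  have "((\<lambda>z. k (?\<psi> z)) has_derivative \<kappa>) (at (x, frame c x \<eta>))"
    using diff_chain_at[OF smooth_near_has_derivative[OF \<psi>], of k] k \<psi>x
    by (simp add: o_def \<kappa>_def[abs_def] frechet_derivative_works)
  then have \<kappa>: "((\<lambda>z. K (cinv ?C z)) has_derivative \<kappa>) (at (x, frame c x \<eta>))"
  proof (rule has_derivative_transform_nhds)
    show "\<forall>\<^sub>F z in nhds (x, frame c x \<eta>). K (cinv ?C z) = k (?\<psi> z)"
      using eventually_nhds_fst[OF eventually_cinv[OF atlas c(1,1,2,2)], folded x_def]
    proof eventually_elim
      case (elim z)
      then show ?case
        using triv[of "cinv c (fst z)" "coframe c (fst z) (snd z)"] frame_coframe[OF c(1), of "cinv c (fst z)" "snd z"]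
        by (simp add: k_def)
    qed
  qed
  moreover have "\<kappa> (u, frechet_derivative (\<lambda>x. frame c x \<eta>) (at x) u + frame c x \<theta>)
      = frechet_derivative (\<lambda>x. k (x, \<eta>)) (at x) u + frechet_derivative (\<lambda>\<theta>. k (x, \<theta>)) (at \<eta>) \<theta>" for u \<theta>
  proof -
    have F: "smooth_near UNIV (\<lambda>z. frame c (fst z) (snd z)) (x, \<eta>)" unfolding x_def by (rule frame_smooth[OF c])
    have "frechet_derivative (frame c x) (at \<eta>) v = frame c x v" for v
      using linear_frame[OF c] by (intro frechet_derivative_eqI) (simp add: x_def linear_imp_has_derivative)
    then have DF: "frechet_derivative (\<lambda>z. frame c (fst z) (snd z)) (at (x, \<eta>)) (u, \<theta>)
       = frechet_derivative (\<lambda>x. frame c x \<eta>) (at x) u + frame c x \<theta>" for u \<theta>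
      using frechet_derivative_split[OF smooth_near_differentiable[OF F]] by simp
    have d\<phi>: "(?\<phi> has_derivative (\<lambda>v. (fst v, frechet_derivative (\<lambda>z. frame c (fst z) (snd z)) (at (x, \<eta>)) v))) (at (x, \<eta>))"
      using smooth_near_has_derivative[OF F] by (intro has_derivative_Pair has_derivative_fst has_derivative_ident)
    have "((\<lambda>z. K (cinv ?C (?\<phi> z))) has_derivative
        (\<lambda>v. \<kappa> (fst v, frechet_derivative (\<lambda>z. frame c (fst z) (snd z)) (at (x, \<eta>)) v))) (at (x, \<eta>))"
      using diff_chain_at[OF d\<phi>, of "\<lambda>z. K (cinv ?C z)" \<kappa>] \<kappa> by (simp add: o_def)
    then have "(k has_derivative
        (\<lambda>v. \<kappa> (fst v, frechet_derivative (\<lambda>z. frame c (fst z) (snd z)) (at (x, \<eta>)) v))) (at (x, \<eta>))"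
    proof (rule has_derivative_transform_nhds)
      show "\<forall>\<^sub>F z in nhds (x, \<eta>). k z = K (cinv ?C (?\<phi> z))"
        using eventually_nhds_fst[OF eventually_cinv[OF atlas c(1,1,2,2)], folded x_def]
      proof eventually_elim
        case (elim z)
        then show ?case using triv[of "cinv c (fst z)" "snd z"] by (simp add: k_def)
      qed
    qed
    from frechet_derivative_eqI[OF this, of "(u, \<theta>)"] show ?thesis
      using frechet_derivative_split[OF k, of u \<theta>] by (simp add: DF)
  qed
  ultimately show thesis by (rule that)
qed

lemma (in lie) pdiff_\<eta>_apply:
  assumes L: "smooth_map TA euclidean_atlas L" and p: "p \<in> carrier G"
  shows "blinfun_apply (pdiff_\<eta> G L p \<eta>) v = frechet_derivative (\<lambda>\<theta>. L (left_triv G (p, \<theta>))) (at \<eta>) v"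
proof -
  note c = chart_at_carrier[OF p]
  have "(\<lambda>\<theta>. L (left_triv G (p, \<theta>))) differentiable (at \<eta>)"
    using partial_frechet_derivative(1)[OF smooth_near_differentiable[OF trivialized_smooth[OF L c]]]
    by (auto simp: cinv_coords[OF atlas c] differentiable_def)
  then have "bounded_linear (frechet_derivative (\<lambda>\<theta>. L (left_triv G (p, \<theta>))) (at \<eta>))"
    using frechet_derivative_works has_derivative_bounded_linear by blast
  then show ?thesis by (simp add: pdiff_\<eta>_def bounded_linear_Blinfun_apply)
qed

lemma (in lie) pull_pdiff_h_apply:
  assumes L: "smooth_map TA euclidean_atlas L" and c: "c \<in> A" "p \<in> cdom c"
  shows "blinfun_apply (pull G p (pdiff_h G L p \<eta>)) v
    = frechet_derivative (\<lambda>x. L (left_triv G (cinv c x, \<eta>))) (at (coords c p)) (frame c (coords c p) v)"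
proof -
  have p: "p \<in> carrier G" using c by (rule cdom_carrier)
  let ?f = "\<lambda>g. L (left_triv G (g, \<eta>))"
  have D: "((\<lambda>x. ?f (cinv c x)) has_derivative frechet_derivative (\<lambda>x. ?f (cinv c x)) (at (coords c p))) (at (coords c p))"
    if c: "c \<in> A" "p \<in> cdom c" for c
    using partial_frechet_derivative(2)[OF smooth_near_differentiable[OF trivialized_smooth[OF L c]], of \<eta>]
    by (auto simp: differentiable_def frechet_derivative_works[symmetric])
  note c0 = chart_at_carrier[OF p]
  have "bounded_linear (differential A ?f p)"
    using has_derivative_bounded_linear[OF D[OF c0]] by (simp add: differential_def[abs_def] o_def)
  moreover have "bounded_linear (push G p)"
    using linear_frame[OF c0] by (simp add: push_frame[OF p, abs_def] linear_conv_bounded_linear)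
  ultimately have "blinfun_apply (pull G p (pdiff_h G L p \<eta>)) v = differential A ?f p (push G p v)"
    by (simp add: pull_def pdiff_h_def bounded_linear_Blinfun_apply bounded_linear_compose)
  then show ?thesis
    using differential_coords[OF atlas c D[OF c]] by (simp add: coords_tangent_chart frame_push[OF c])
qed

lemma (in lie) ad_star_apply: "blinfun_apply (ad_star G a \<phi>) v = blinfun_apply \<phi> (left_bracket G a v)"
  using linear_left_bracket(1)[of a]
  by (simp add: ad_star_def bounded_linear_Blinfun_apply bounded_linear_compose blinfun.bounded_linear_right linear_conv_bounded_linear)

context lie
begin

lemma curve_in_carrier:
  assumes "smooth_curve A I h" "t \<in> I" shows "h t \<in> carrier G"
proof -
  from assms obtain c J where "c \<in> A" "t \<in> J" "h ` (I \<inter> J) \<subseteq> cdom c" unfolding smooth_curve_def by blast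
  then show ?thesis using assms(2) cdom_carrier by blast
qed

text \<open>The variation of \<open>h\<^sub>* \<eta>\<close> generated by \<open>h\<^sub>* \<xi>\<close> is, in the left trivialization,
  \<open>\<delta>h = h\<^sub>* \<xi>\<close> and \<open>\<delta>\<eta> = \<xi>\<^sup>\<cdot> + [\<eta>, \<xi>]\<close>.\<close>

lemma first_variation_integrand:
  assumes L: "smooth_map TA euclidean_atlas L" and t: "t0 < t1" "t \<in> {t0..t1}"
    and adm: "admissible G t0 t1 h \<eta>" and \<xi>: "smooth_on {t0..t1} \<xi>"
    and K: "\<And>g \<theta>. g \<in> carrier G \<Longrightarrow> K (left_triv G (g, \<theta>)) = L (left_triv G (g, \<theta>)) - blinfun_apply \<mu> \<theta>"
  shows "differential TA K (left_triv G (h t, \<eta> t)) (snd (variation A t0 t1 (\<lambda>s. left_triv G (h s, \<xi> s)) t)) =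
    blinfun_apply (pull G (h t) (pdiff_h G L (h t) (\<eta> t)) + ad_star G (\<eta> t) (pdiff_\<eta> G L (h t) (\<eta> t) - \<mu>)) (\<xi> t)
    + blinfun_apply (pdiff_\<eta> G L (h t) (\<eta> t) - \<mu>) (vector_derivative \<xi> (at t within {t0..t1}))"
proof -
  let ?I = "{t0..t1}"
  have h: "smooth_curve A ?I h" and lift: "left_triv G (h t, \<eta> t) = tangent_lift A ?I h t"
    using adm t unfolding admissible_def by auto
  have p: "h t \<in> carrier G" using h t(2) by (rule curve_in_carrier)
  define c where "c = chart_at A (h t)"
  have c: "c \<in> A" "h t \<in> cdom c" using chart_at_carrier[OF p] by (auto simp: c_def)
  define x where "x = coords c (h t)"
  note hx = smooth_curve_charts[OF atlas c h t(2)]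
  define x' where "x' = vector_derivative (\<lambda>s. coords c (h s)) (at t within ?I)"
  have x': "((\<lambda>s. coords c (h s)) has_vector_derivative x') (at t within ?I)"
    unfolding x'_def using hx(1) by (rule smooth_near_has_vector_derivative)
  have x'_eq: "x' = frame c x (\<eta> t)"
    using tangent_lift_coords[OF atlas c t hx(2) x'] coords_left_triv[OF c, of "\<eta> t"] lift
    by (simp add: x_def)
  define \<xi>' where "\<xi>' = vector_derivative \<xi> (at t within ?I)"
  have \<xi>': "(\<xi> has_vector_derivative \<xi>') (at t within ?I)"
    unfolding \<xi>'_def using smooth_near_on[OF \<xi> t(2)] by (rule smooth_near_has_vector_derivative)
  define y' where "y' = frechet_derivative (\<lambda>x. frame c x (\<xi> t)) (at x) x' + frame c x \<xi>'"
  have y': "((\<lambda>s. coords (tangent_chart A c) (left_triv G (h s, \<xi> s))) has_vector_derivative (x', y')) (at t within ?I)"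
  proof -
    let ?F = "\<lambda>z. frame c (fst z) (snd z)"
    have F: "smooth_near UNIV ?F (x, \<xi> t)" unfolding x_def by (rule frame_smooth[OF c])
    have "frechet_derivative (frame c x) (at (\<xi> t)) v = frame c x v" for v
      using linear_frame[OF c] by (intro frechet_derivative_eqI) (simp add: x_def linear_imp_has_derivative)
    then have "frechet_derivative ?F (at (x, \<xi> t)) (x', \<xi>') = y'"
      using frechet_derivative_split[OF smooth_near_differentiable[OF F]] by (simp add: y'_def)
    moreover have "(?F has_derivative frechet_derivative ?F (at (x, \<xi> t))) (at (x, \<xi> t) within X)" for X
      using smooth_near_has_derivative[OF F] by (rule has_derivative_at_withinI)
    ultimately have "((\<lambda>s. frame c (coords c (h s)) (\<xi> s)) has_vector_derivative y') (at t within ?I)"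
      using vector_derivative_diff_chain_within[OF has_vector_derivative_Pair[OF x' \<xi>'],
          of ?F "frechet_derivative ?F (at (x, \<xi> t))"] by (simp add: o_def x_def)
    with x' have "((\<lambda>s. (coords c (h s), frame c (coords c (h s)) (\<xi> s))) has_vector_derivative (x', y')) (at t within ?I)"
      by (rule has_vector_derivative_Pair)
    then show ?thesis unfolding has_vector_derivative_def
    proof (rule has_derivative_transform_eventually)
      show "\<forall>\<^sub>F s in at t within ?I. (coords c (h s), frame c (coords c (h s)) (\<xi> s))
          = coords (tangent_chart A c) (left_triv G (h s, \<xi> s))"
        unfolding eventually_at_filter using hx(2) by eventually_elim (simp add: coords_left_triv[OF c(1)])
    qed (use t c in \<open>auto simp: coords_left_triv\<close>)
  qed
  let ?k = "\<lambda>z. K (left_triv G (cinv c (fst z), snd z))"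
  let ?l = "\<lambda>z. L (left_triv G (cinv c (fst z), snd z))"
  have l: "smooth_near UNIV ?l (x, \<eta> t)" unfolding x_def by (rule trivialized_smooth[OF L c])
  note dl = smooth_near_differentiable[OF l]
  have ev: "\<forall>\<^sub>F y in nhds x. cinv c y \<in> carrier G"
    using eventually_cinv[OF atlas c(1,1,2,2), folded x_def] by eventually_elim (use cdom_carrier c in blast)
  have "(?k has_derivative (\<lambda>v. frechet_derivative ?l (at (x, \<eta> t)) v - blinfun_apply \<mu> (snd v))) (at (x, \<eta> t))"
  proof (rule has_derivative_transform_nhds)
    show "((\<lambda>z. ?l z - blinfun_apply \<mu> (snd z)) has_derivative
        (\<lambda>v. frechet_derivative ?l (at (x, \<eta> t)) v - blinfun_apply \<mu> (snd v))) (at (x, \<eta> t))"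
      using smooth_near_has_derivative[OF l]
      by (intro has_derivative_diff bounded_linear.has_derivative[OF blinfun.bounded_linear_right] has_derivative_snd has_derivative_ident)
    show "\<forall>\<^sub>F z in nhds (x, \<eta> t). ?k z = ?l z - blinfun_apply \<mu> (snd z)"
      using eventually_nhds_fst[OF ev] by eventually_elim (simp add: K)
  qed
  then have k: "?k differentiable (at (x, \<eta> t))" by (auto simp: differentiable_def)
  have partial1: "((\<lambda>y. ?l (y, \<eta> t)) has_derivative frechet_derivative (\<lambda>y. ?l (y, \<eta> t)) (at x)) (at x)"
    using partial_frechet_derivative(2)[OF dl] by (auto simp: differentiable_def frechet_derivative_works[symmetric])
  have k1: "frechet_derivative (\<lambda>y. ?k (y, \<eta> t)) (at x) v = frechet_derivative (\<lambda>y. ?l (y, \<eta> t)) (at x) v" for v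
  proof (rule frechet_derivative_eqI, rule has_derivative_transform_nhds)
    show "((\<lambda>y. ?l (y, \<eta> t) - blinfun_apply \<mu> (\<eta> t)) has_derivative frechet_derivative (\<lambda>y. ?l (y, \<eta> t)) (at x)) (at x)"
      using has_derivative_diff[OF partial1 has_derivative_const] by simp
    show "\<forall>\<^sub>F y in nhds x. ?k (y, \<eta> t) = ?l (y, \<eta> t) - blinfun_apply \<mu> (\<eta> t)"
      using ev by eventually_elim (simp add: K)
  qed
  have xh: "cinv c x = h t" by (simp add: x_def cinv_coords[OF atlas c])
  have k2: "frechet_derivative (\<lambda>\<theta>. ?k (x, \<theta>)) (at (\<eta> t)) v = blinfun_apply (pdiff_\<eta> G L (h t) (\<eta> t) - \<mu>) v" for v
  proof -
    have "((\<lambda>\<theta>. ?l (x, \<theta>)) has_derivative blinfun_apply (pdiff_\<eta> G L (h t) (\<eta> t))) (at (\<eta> t))"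
      using partial_frechet_derivative(1)[OF dl]
      by (auto simp: pdiff_\<eta>_apply[OF L p, abs_def] xh differentiable_def frechet_derivative_works[symmetric])
    then have "((\<lambda>\<theta>. ?k (x, \<theta>)) has_derivative blinfun_apply (pdiff_\<eta> G L (h t) (\<eta> t) - \<mu>)) (at (\<eta> t))"
      using has_derivative_diff[OF _ bounded_linear_imp_has_derivative[OF blinfun.bounded_linear_right[of \<mu>]]]
      by (simp add: xh K p blinfun.diff_left[abs_def])
    then show ?thesis by (rule frechet_derivative_eqI)
  qed
  obtain \<kappa> where \<kappa>: "((\<lambda>z. K (cinv (tangent_chart A c) z)) has_derivative \<kappa>) (at (x, frame c x (\<eta> t)))"
    "\<And>u \<theta>. \<kappa> (u, frechet_derivative (\<lambda>x. frame c x (\<eta> t)) (at x) u + frame c x \<theta>)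
      = frechet_derivative (\<lambda>y. ?k (y, \<eta> t)) (at x) u + frechet_derivative (\<lambda>\<theta>. ?k (x, \<theta>)) (at (\<eta> t)) \<theta>"
    by (rule trivialized_derivative[OF c, of K "\<eta> t", folded x_def, OF k]) (rule that)
  have "differential TA K (left_triv G (h t, \<eta> t)) (snd (variation A t0 t1 (\<lambda>s. left_triv G (h s, \<xi> s)) t))
      = \<kappa> (snd (coords (tangent_chart A c) (left_triv G (h t, \<xi> t))), y')"
    unfolding lift c_def
    using hx(2) y' \<kappa>(1) c unfolding c_def x_def
    by (intro variation_coords[OF atlas _ _ t]) (simp_all add: left_triv_def x'_eq x_def c_def)
  also have "\<dots> = \<kappa> (frame c x (\<xi> t), y')" by (simp add: coords_left_triv[OF c] x_def)
  also have "y' = frechet_derivative (\<lambda>x. frame c x (\<eta> t)) (at x) (frame c x (\<xi> t))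
      + frame c x (left_bracket G (\<eta> t) (\<xi> t) + \<xi>')"
    using frame_bracket[OF c, of "\<xi> t" "\<eta> t"] linear_frame[OF c]
    by (simp add: y'_def x'_eq x_def linear_add algebra_simps)
  also have "\<kappa> (frame c x (\<xi> t), \<dots>) = frechet_derivative (\<lambda>y. ?l (y, \<eta> t)) (at x) (frame c x (\<xi> t))
      + blinfun_apply (pdiff_\<eta> G L (h t) (\<eta> t) - \<mu>) (left_bracket G (\<eta> t) (\<xi> t) + \<xi>')"
    by (simp only: \<kappa>(2) k1 k2)
  also have "frechet_derivative (\<lambda>y. ?l (y, \<eta> t)) (at x) (frame c x (\<xi> t))
      = blinfun_apply (pull G (h t) (pdiff_h G L (h t) (\<eta> t))) (\<xi> t)"
    by (simp add: pull_pdiff_h_apply[OF L c] x_def)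
  finally show ?thesis
    by (simp add: \<xi>'_def blinfun.add_left blinfun.add_right ad_star_apply)
qed

text \<open>Near each \<open>t\<close> both covector curves are partial derivatives of \<open>L (g\<^sub>* \<theta>)\<close> in one chart,
  evaluated along a smooth curve.\<close>

lemma momentum_smooth:
  assumes L: "smooth_map TA euclidean_atlas L" and t: "t \<in> {t0..t1}"
    and adm: "admissible G t0 t1 h \<eta>"
  shows "smooth_near {t0..t1} (\<lambda>s. pdiff_\<eta> G L (h s) (\<eta> s)) t"
    and "smooth_near {t0..t1} (\<lambda>s. pull G (h s) (pdiff_h G L (h s) (\<eta> s))) t"
proof -
  let ?I = "{t0..t1}"
  have h: "smooth_curve A ?I h" and \<eta>: "smooth_near ?I \<eta> t"
    using adm t smooth_near_on unfolding admissible_def by blast+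
  have p: "h t \<in> carrier G" using h t by (rule curve_in_carrier)
  define c where "c = chart_at A (h t)"
  have c: "c \<in> A" "h t \<in> cdom c" using chart_at_carrier[OF p] by (auto simp: c_def)
  note hx = smooth_curve_charts[OF atlas c h t]
  let ?l = "\<lambda>z. L (left_triv G (cinv c (fst z), snd z))"
  note l = trivialized_smooth[OF L c, of "\<eta> t"]
  show "smooth_near ?I (\<lambda>s. pdiff_\<eta> G L (h s) (\<eta> s)) t"
  proof (rule smooth_near_blinfun[OF t], rule smooth_near_cong)
    fix b :: 'e
    show "smooth_near ?I (\<lambda>s. frechet_derivative (\<lambda>\<theta>. ?l (coords c (h s), \<theta>)) (at (\<eta> s)) b) t"
      using l hx(1) \<eta> t by (intro smooth_near_partial2[of ?l "\<lambda>s. coords c (h s)"] smooth_near_const)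
    show "\<forall>\<^sub>F s in nhds t. s \<in> ?I \<longrightarrow> blinfun_apply (pdiff_\<eta> G L (h s) (\<eta> s)) b
        = frechet_derivative (\<lambda>\<theta>. ?l (coords c (h s), \<theta>)) (at (\<eta> s)) b"
      using hx(2) by eventually_elim
        (simp add: pdiff_\<eta>_apply[OF L] cinv_coords[OF atlas c(1)] cdom_carrier[OF c(1)])
  qed
  show "smooth_near ?I (\<lambda>s. pull G (h s) (pdiff_h G L (h s) (\<eta> s))) t"
  proof (rule smooth_near_blinfun[OF t], rule smooth_near_cong)
    fix b :: 'e
    have "smooth_near ?I (\<lambda>s. frame c (coords c (h s)) b) t"
      using smooth_near_compose[OF frame_field_smooth[OF c] hx(1)] .
    then show "smooth_near ?I (\<lambda>s. frechet_derivative (\<lambda>x. ?l (x, \<eta> s)) (at (coords c (h s))) (frame c (coords c (h s)) b)) t"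
      using l hx(1) \<eta> t by (intro smooth_near_partial1[of ?l "\<lambda>s. coords c (h s)"])
    show "\<forall>\<^sub>F s in nhds t. s \<in> ?I \<longrightarrow> blinfun_apply (pull G (h s) (pdiff_h G L (h s) (\<eta> s))) b
        = frechet_derivative (\<lambda>x. ?l (x, \<eta> s)) (at (coords c (h s))) (frame c (coords c (h s)) b)"
      using hx(2) by eventually_elim (simp add: pull_pdiff_h_apply[OF L c(1)])
  qed
qed

lemma ad_star_smooth:
  assumes "smooth_near S \<phi> t" "smooth_near S \<eta> t"
  shows "smooth_near S (\<lambda>s. ad_star G (\<eta> s) (\<phi> s)) t"
proof (rule smooth_near_blinfun)
  show "t \<in> S" using assms(1) by (rule smooth_near_mem)
  have "smooth_near S (\<lambda>s. left_bracket G (\<eta> s) b) t" for b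
    using linear_left_bracket(2)[of b] assms(2)
    by (intro smooth_near_bounded_linear[of "\<lambda>a. left_bracket G a b"]) (simp add: linear_conv_bounded_linear)
  then show "smooth_near S (\<lambda>s. blinfun_apply (ad_star G (\<eta> s) (\<phi> s)) b) t" for b
    using assms(1) by (simp add: ad_star_apply smooth_near_blinfun_apply)
qed

end

section \<open>The fundamental lemma of the calculus of variations\<close>

lemma real_polynomial_function_smooth: "real_polynomial_function f \<Longrightarrow> Ck_on k S f"
proof (induction rule: real_polynomial_function.induct)
  case (mult f g)
  then show ?case using Ck_on_scaleR[of k S f g] by simp
qed (auto intro: Ck_on_bounded_linear[OF _ Ck_on_ident] Ck_on_const Ck_on_add)

text \<open>Multiplied by \<open>(t - a) (b - t)\<close>, polynomials are smooth test functions that vanish at the end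
  points. As they approximate \<open>g\<close> uniformly, \<open>(t - a) (b - t) g\<^sup>2\<close> integrates to zero, and \<open>g\<close>
  vanishes in the interior, hence by continuity everywhere.\<close>

lemma vanishing_against_polynomials:
  fixes g :: "real \<Rightarrow> real"
  assumes ab: "a < b" and g: "continuous_on {a..b} g"
    and int: "\<And>\<psi>. real_polynomial_function \<psi> \<Longrightarrow> integral {a..b} (\<lambda>t. g t * ((t - a) * (b - t) * \<psi> t)) = 0"
    and t: "t \<in> {a..b}"
  shows "g t = 0"
proof -
  let ?w = "\<lambda>t. (t - a) * (b - t)"
  have C: "continuous_on {a..b} (\<lambda>t. ?w t * (g t * g t))" "continuous_on {a..b} (\<lambda>t. \<bar>?w t * g t\<bar>)"
    by (intro continuous_intros g)+
  define c where "c = integral {a..b} (\<lambda>t. \<bar>?w t * g t\<bar>)"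
  have c0: "c \<ge> 0" unfolding c_def by (intro integral_nonneg integrable_continuous_real C) simp
  have "\<bar>integral {a..b} (\<lambda>t. ?w t * (g t * g t))\<bar> \<le> 0 + e" if e: "e > 0" for e
  proof -
    have e': "e / (c + 1) > 0" using e c0 by simp
    obtain \<psi> where \<psi>: "real_polynomial_function \<psi>" "\<And>t. t \<in> {a..b} \<Longrightarrow> \<bar>g t - \<psi> t\<bar> < e / (c + 1)"
      using Stone_Weierstrass_real_polynomial_function[OF compact_Icc g e'] by blast
    have cont\<psi>: "continuous_on {a..b} \<psi>" using real_polynomial_function_smooth[OF \<psi>(1), of 0] by simp
    have "integral {a..b} (\<lambda>t. ?w t * (g t * g t)) = integral {a..b} (\<lambda>t. ?w t * g t * (g t - \<psi> t) + g t * (?w t * \<psi> t))"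
      by (rule arg_cong[of _ _ "integral {a..b}"]) (auto simp: algebra_simps)
    also have "\<dots> = integral {a..b} (\<lambda>t. ?w t * g t * (g t - \<psi> t))"
      using int[OF \<psi>(1)] by (subst integral_add) (auto intro!: integrable_continuous_real continuous_intros g cont\<psi>)
    also have "\<bar>\<dots>\<bar> \<le> integral {a..b} (\<lambda>t. e / (c + 1) * \<bar>?w t * g t\<bar>)"
    proof -
      have "norm (integral {a..b} (\<lambda>t. ?w t * g t * (g t - \<psi> t))) \<le> integral {a..b} (\<lambda>t. e / (c + 1) * \<bar>?w t * g t\<bar>)"
      proof (rule integral_norm_bound_integral)
        show "(\<lambda>t. ?w t * g t * (g t - \<psi> t)) integrable_on {a..b}" "(\<lambda>t. e / (c + 1) * \<bar>?w t * g t\<bar>) integrable_on {a..b}"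
          by (intro integrable_continuous_real continuous_intros g cont\<psi>)+
        fix s assume "s \<in> {a..b}"
        then have "\<bar>?w s * g s\<bar> * \<bar>g s - \<psi> s\<bar> \<le> \<bar>?w s * g s\<bar> * (e / (c + 1))"
          using \<psi>(2) by (intro mult_left_mono) (auto intro: less_imp_le)
        then show "norm (?w s * g s * (g s - \<psi> s)) \<le> e / (c + 1) * \<bar>?w s * g s\<bar>"
          by (simp only: real_norm_def abs_mult mult.commute)
      qed
      then show ?thesis by simp
    qed
    also have "\<dots> = e / (c + 1) * c" by (simp only: integral_mult_right c_def)
    also have "\<dots> \<le> e" using e c0 by (simp add: field_simps)
    finally show ?thesis by simp
  qed
  then have "\<bar>integral {a..b} (\<lambda>t. ?w t * (g t * g t))\<bar> \<le> 0" by (rule field_le_epsilon)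
  then have "integral {a..b} (\<lambda>t. ?w t * (g t * g t)) = 0" by simp
  then have "\<forall>s\<in>{a..b}. ?w s * (g s * g s) = 0" using integral_eq_0_iff[OF C(1) ab] by simp
  then have "g s = 0" if "s \<in> {a<..<b}" for s using that by force
  moreover have "closure {a<..<b} = {a..b}" using ab by simp
  ultimately show ?thesis using continuous_constant_on_closure[of "{a<..<b}" g 0 t] g t by metis
qed

text \<open>Integration by parts moves the derivative of \<open>\<xi>\<close> to \<open>\<beta>\<close>. The remaining integrand is tested with
  a scalar function times a fixed vector of \<open>d\<close>.\<close>

lemma euler_lagrange_annihilator:
  fixes \<alpha> \<beta> :: "real \<Rightarrow> 'e::euclidean_space \<Rightarrow>\<^sub>L real"
  assumes ab: "a < b" and d: "subspace d"
    and \<alpha>: "\<And>t. t \<in> {a..b} \<Longrightarrow> smooth_near {a..b} \<alpha> t" and \<beta>: "\<And>t. t \<in> {a..b} \<Longrightarrow> smooth_near {a..b} \<beta> t"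
  shows "(\<forall>\<xi>. smooth_on {a..b} \<xi> \<and> (\<forall>t\<in>{a..b}. \<xi> t \<in> d) \<and> \<xi> a = 0 \<and> \<xi> b = 0 \<longrightarrow>
      integral {a..b} (\<lambda>t. blinfun_apply (\<alpha> t) (\<xi> t) + blinfun_apply (\<beta> t) (vector_derivative \<xi> (at t within {a..b}))) = 0)
    \<longleftrightarrow> (\<forall>t\<in>{a..b}. \<alpha> t - vector_derivative \<beta> (at t within {a..b}) \<in> Ann d)"
    (is "?E \<longleftrightarrow> ?A")
proof -
  define \<beta>' where "\<beta>' t = vector_derivative \<beta> (at t within {a..b})" for t
  have \<beta>': "(\<beta> has_vector_derivative \<beta>' t) (at t within {a..b})" if "t \<in> {a..b}" for t
    unfolding \<beta>'_def using \<beta>[OF that] by (rule smooth_near_has_vector_derivative)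
  have cont\<beta>': "continuous_on {a..b} \<beta>'"
    unfolding \<beta>'_def using smooth_near_vector_derivative(2)[OF ab \<beta>] .
  have cont\<alpha>: "continuous_on {a..b} \<alpha>"
    unfolding continuous_on_eq_continuous_within using \<alpha> smooth_near_continuous by blast
  have parts: "integral {a..b} (\<lambda>t. blinfun_apply (\<alpha> t) (\<xi> t) + blinfun_apply (\<beta> t) (vector_derivative \<xi> (at t within {a..b})))
      = integral {a..b} (\<lambda>t. blinfun_apply (\<alpha> t - \<beta>' t) (\<xi> t))"
    if \<xi>: "smooth_on {a..b} \<xi>" "\<xi> a = 0" "\<xi> b = 0" for \<xi>
  proof -
    note \<xi>s = smooth_near_on[OF \<xi>(1)]
    have cont\<xi>: "continuous_on {a..b} \<xi>"
      unfolding continuous_on_eq_continuous_within using \<xi>s smooth_near_continuous by blast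
    have "((\<lambda>t. blinfun_apply (\<beta> t) (\<xi> t)) has_vector_derivative
        (blinfun_apply (\<beta> t) (vector_derivative \<xi> (at t within {a..b})) + blinfun_apply (\<beta>' t) (\<xi> t))) (at t within {a..b})"
      if "t \<in> {a..b}" for t
      using bounded_bilinear.has_vector_derivative[OF bounded_bilinear_blinfun_apply \<beta>'[OF that]
          smooth_near_has_vector_derivative[OF \<xi>s[OF that]]] .
    from fundamental_theorem_of_calculus[OF less_imp_le[OF ab] this] \<xi>(2,3)
    have "((\<lambda>t. blinfun_apply (\<beta> t) (vector_derivative \<xi> (at t within {a..b})) + blinfun_apply (\<beta>' t) (\<xi> t)) has_integral 0) {a..b}"
      by simp
    moreover have "((\<lambda>t. blinfun_apply (\<alpha> t - \<beta>' t) (\<xi> t)) has_integral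
        integral {a..b} (\<lambda>t. blinfun_apply (\<alpha> t - \<beta>' t) (\<xi> t))) {a..b}"
      using cont\<alpha> cont\<xi> cont\<beta>'
      by (intro integrable_integral integrable_continuous_real continuous_intros)
    ultimately have "((\<lambda>t. (blinfun_apply (\<beta> t) (vector_derivative \<xi> (at t within {a..b})) + blinfun_apply (\<beta>' t) (\<xi> t))
        + blinfun_apply (\<alpha> t - \<beta>' t) (\<xi> t)) has_integral 0 + integral {a..b} (\<lambda>t. blinfun_apply (\<alpha> t - \<beta>' t) (\<xi> t))) {a..b}"
      by (rule has_integral_add)
    from integral_unique[OF this] show ?thesis by (simp add: blinfun.diff_left algebra_simps)
  qed
  show ?thesis
  proof
    assume E: ?E
    show ?A unfolding Ann_def \<beta>'_def[symmetric]
    proof (intro ballI CollectI)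
      fix t v assume t: "t \<in> {a..b}" and v: "v \<in> d"
      show "blinfun_apply (\<alpha> t - \<beta>' t) v = 0"
      proof (rule vanishing_against_polynomials[OF ab _ _ t])
        show "continuous_on {a..b} (\<lambda>t. blinfun_apply (\<alpha> t - \<beta>' t) v)"
          using cont\<alpha> cont\<beta>' by (intro continuous_intros)
        fix \<psi> :: "real \<Rightarrow> real" assume \<psi>: "real_polynomial_function \<psi>"
        have "real_polynomial_function (\<lambda>t. (t - a) * (b - t) * \<psi> t)"
          by (intro real_polynomial_function.intros(2,4) real_polynomial_function_diff \<psi>
              real_polynomial_function.intros(1)[OF bounded_linear_ident])
        then have "smooth_on {a..b} (\<lambda>t. ((t - a) * (b - t) * \<psi> t) *\<^sub>R v)"
          unfolding smooth_on_def by (intro allI Ck_on_scaleR Ck_on_const real_polynomial_function_smooth)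
        from E[rule_format, OF conjI[OF this]] parts[OF this]
        show "integral {a..b} (\<lambda>t. blinfun_apply (\<alpha> t - \<beta>' t) v * ((t - a) * (b - t) * \<psi> t)) = 0"
          using d v by (simp add: subspace_scale blinfun.scaleR_right mult.commute)
      qed
    qed
  next
    assume A: ?A
    show ?E
    proof (intro allI impI, elim conjE)
      fix \<xi> assume \<xi>: "smooth_on {a..b} \<xi>" "\<forall>t\<in>{a..b}. \<xi> t \<in> d" "\<xi> a = 0" "\<xi> b = 0"
      have "integral {a..b} (\<lambda>t. blinfun_apply (\<alpha> t - \<beta>' t) (\<xi> t)) = integral {a..b} (\<lambda>t. 0)"
        using A \<xi>(2) by (intro integral_cong) (auto simp: Ann_def \<beta>'_def)
      then show "integral {a..b} (\<lambda>t. blinfun_apply (\<alpha> t) (\<xi> t) + blinfun_apply (\<beta> t) (vector_derivative \<xi> (at t within {a..b}))) = 0"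
        using parts[OF \<xi>(1,3,4)] by simp
    qed
  qed
qed

section \<open>Nonholonomic and vakonomic extremals\<close>

text \<open>Common to both kinds of extremals: the time-dependent Lagrangian differs from \<open>L\<close> by a
  functional \<open>\<mu> t\<close> that is linear in the velocity and independent of the base point, which only
  replaces the momentum \<open>\<partial>L/\<partial>\<eta>\<close> by \<open>\<partial>L/\<partial>\<eta> - \<mu>\<close>. The nonholonomic case has \<open>\<mu> = 0\<close>; in the
  vakonomic case \<open>\<mu> = \<lambda>\<close>, and \<open>d\<close> is the whole Lie algebra.\<close>

lemma (in lie) extremal_iff_annihilator:
  assumes L: "smooth_map TA euclidean_atlas L" and t: "t0 < t1" and adm: "admissible G t0 t1 h \<eta>"
    and d: "subspace d" and \<mu>: "\<And>t. t \<in> {t0..t1} \<Longrightarrow> smooth_near {t0..t1} \<mu> t"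
    and K: "\<And>t g \<theta>. t \<in> {t0..t1} \<Longrightarrow> g \<in> carrier G
      \<Longrightarrow> K t (left_triv G (g, \<theta>)) = L (left_triv G (g, \<theta>)) - blinfun_apply (\<mu> t) \<theta>"
  shows "(\<forall>\<xi>. smooth_on {t0..t1} \<xi> \<and> (\<forall>t\<in>{t0..t1}. \<xi> t \<in> d) \<and> \<xi> t0 = 0 \<and> \<xi> t1 = 0
      \<longrightarrow> action_variation G t0 t1 K h \<eta> \<xi> = 0) \<longleftrightarrow>
    (\<forall>t\<in>{t0..t1}. pull G (h t) (pdiff_h G L (h t) (\<eta> t))
      - vector_derivative (\<lambda>s. pdiff_\<eta> G L (h s) (\<eta> s) - \<mu> s) (at t within {t0..t1})
      + ad_star G (\<eta> t) (pdiff_\<eta> G L (h t) (\<eta> t) - \<mu> t) \<in> Ann d)"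
proof -
  define \<beta> where "\<beta> s = pdiff_\<eta> G L (h s) (\<eta> s) - \<mu> s" for s
  define \<alpha> where "\<alpha> s = pull G (h s) (pdiff_h G L (h s) (\<eta> s)) + ad_star G (\<eta> s) (\<beta> s)" for s
  have \<eta>: "smooth_near {t0..t1} \<eta> s" if "s \<in> {t0..t1}" for s
    using adm that smooth_near_on unfolding admissible_def by blast
  have \<beta>: "smooth_near {t0..t1} \<beta> s" if "s \<in> {t0..t1}" for s
    unfolding \<beta>_def using momentum_smooth(1)[OF L that adm] \<mu>[OF that] by (rule smooth_near_diff)
  have \<alpha>: "smooth_near {t0..t1} \<alpha> s" if "s \<in> {t0..t1}" for s
    unfolding \<alpha>_def using momentum_smooth(2)[OF L that adm] ad_star_smooth[OF \<beta>[OF that] \<eta>[OF that]]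
    by (rule smooth_near_add)
  have "action_variation G t0 t1 K h \<eta> \<xi> = integral {t0..t1}
      (\<lambda>t. blinfun_apply (\<alpha> t) (\<xi> t) + blinfun_apply (\<beta> t) (vector_derivative \<xi> (at t within {t0..t1})))"
    if "smooth_on {t0..t1} \<xi>" for \<xi>
    unfolding action_variation_def action_differential_def \<alpha>_def \<beta>_def
    by (intro integral_cong first_variation_integrand[OF L t _ adm that] K)
  then show ?thesis
    using euler_lagrange_annihilator[OF t d \<alpha> \<beta>]
    by (simp add: \<alpha>_def \<beta>_def[abs_def] algebra_simps cong: conj_cong imp_cong)
qed

lemma annihilator_vector_derivative:
  assumes ab: "a < b" and lam: "\<And>t. t \<in> {a..b} \<Longrightarrow> smooth_near {a..b} lam t"
    and Ann: "\<forall>t\<in>{a..b}. lam t \<in> Ann d" and t: "t \<in> {a..b}"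
  shows "vector_derivative lam (at t within {a..b}) \<in> Ann d"
  unfolding Ann_def
proof (intro CollectI ballI)
  fix v assume v: "v \<in> d"
  let ?D = "vector_derivative lam (at t within {a..b})"
  have "((\<lambda>s. blinfun_apply (lam s) v) has_vector_derivative blinfun_apply ?D v) (at t within {a..b})"
    using bounded_linear.has_vector_derivative[OF blinfun.bounded_linear_left smooth_near_has_vector_derivative[OF lam[OF t]]] .
  then have "((\<lambda>s. 0) has_vector_derivative blinfun_apply ?D v) (at t within {a..b})"
    using Ann v t unfolding has_vector_derivative_def
    by (elim has_derivative_transform[rotated 2]) (auto simp: Ann_def)
  from vector_derivative_within_closed_interval[OF ab t this]
    vector_derivative_within_closed_interval[OF ab t has_vector_derivative_const[of "0::real"]]
  show "blinfun_apply ?D v = 0" by simp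
qed

theorem lemma5p4:
  fixes G :: "('h, 'e::euclidean_space) lie_structure"
    and L :: "'h \<times> 'e \<Rightarrow> real"
    and d d' :: "'e set"
    and P P' :: "'e \<Rightarrow> 'e"
    and t0 t1 :: real
    and h :: "real \<Rightarrow> 'h"
    and \<eta> :: "real \<Rightarrow> 'e"
  assumes "t0 < t1"
    and "lie_group G"
    and "smooth_map (tangent_atlas (atlas G)) euclidean_atlas L"
    and "splitting d d' P P'"
    and "admissible G t0 t1 h \<eta>"
    and "\<forall>t\<in>{t0..t1}. \<eta> t \<in> d"
  shows
    "(nonholonomic_extremal G t0 t1 L d h \<eta> \<longleftrightarrow>
       (\<forall>t\<in>{t0..t1}.
          pull G (h t) (pdiff_h G L (h t) (\<eta> t))
          - vector_derivative (\<lambda>s. pdiff_\<eta> G L (h s) (\<eta> s)) (at t within {t0..t1})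
          + ad_star G (\<eta> t) (pdiff_\<eta> G L (h t) (\<eta> t)) \<in> Ann d)) \<and>
     (\<forall>lam :: real \<Rightarrow> 'e \<Rightarrow>\<^sub>L real.
       smooth_on {t0..t1} lam \<and> (\<forall>t\<in>{t0..t1}. lam t \<in> Ann d) \<longrightarrow>
       (vakonomic_extremal G t0 t1 (modified_lagrangian G L P' lam) d h \<eta> \<longleftrightarrow>
         (\<forall>t\<in>{t0..t1}. \<forall>a\<in>d.
            blinfun_apply
              (pull G (h t) (pdiff_h G L (h t) (\<eta> t))
               - vector_derivative (\<lambda>s. pdiff_\<eta> G L (h s) (\<eta> s)) (at t within {t0..t1})
               + ad_star G (\<eta> t) (pdiff_\<eta> G L (h t) (\<eta> t) - lam t)) a = 0) \<and>
         (\<forall>t\<in>{t0..t1}. \<forall>b\<in>d'.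
            blinfun_apply
              (pull G (h t) (pdiff_h G L (h t) (\<eta> t))
               - vector_derivative (\<lambda>s. pdiff_\<eta> G L (h s) (\<eta> s) - lam s) (at t within {t0..t1})
               + ad_star G (\<eta> t) (pdiff_\<eta> G L (h t) (\<eta> t) - lam t)) b = 0)))"
proof (intro conjI allI impI)
  let ?I = "{t0..t1}"
  have "group G" using assms(2) unfolding lie_group_def by blast
  then interpret lie G using assms(2) by (intro lie.intro lie_axioms.intro)
  have d: "subspace d" "\<And>\<theta>. \<theta> = P \<theta> + P' \<theta>" "\<And>\<theta>. P \<theta> \<in> d" "\<And>\<theta>. P' \<theta> \<in> d'"
    using assms(4) unfolding splitting_def by auto
  note EL = extremal_iff_annihilator[OF assms(3,1,5)]
  show "nonholonomic_extremal G t0 t1 L d h \<eta> \<longleftrightarrow>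
       (\<forall>t\<in>?I. pull G (h t) (pdiff_h G L (h t) (\<eta> t))
          - vector_derivative (\<lambda>s. pdiff_\<eta> G L (h s) (\<eta> s)) (at t within ?I)
          + ad_star G (\<eta> t) (pdiff_\<eta> G L (h t) (\<eta> t)) \<in> Ann d)"
    using EL[OF d(1), of "\<lambda>_. 0" "\<lambda>_. L"] assms(5,6)
    by (simp add: nonholonomic_extremal_def smooth_near_const)
  fix lam :: "real \<Rightarrow> 'e \<Rightarrow>\<^sub>L real"
  assume "smooth_on ?I lam \<and> (\<forall>t\<in>?I. lam t \<in> Ann d)"
  then have lam: "\<And>t. t \<in> ?I \<Longrightarrow> smooth_near ?I lam t" and Ann: "\<forall>t\<in>?I. lam t \<in> Ann d"
    using smooth_near_on by blast+
  have "modified_lagrangian G L P' lam t (left_triv G (g, \<theta>)) = L (left_triv G (g, \<theta>)) - blinfun_apply (lam t) \<theta>"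
    if "t \<in> ?I" "g \<in> carrier G" for t g \<theta>
  proof -
    have "blinfun_apply (lam t) \<theta> = blinfun_apply (lam t) (P \<theta>) + blinfun_apply (lam t) (P' \<theta>)"
      using d(2)[of \<theta>] by (metis blinfun.add_right)
    also have "blinfun_apply (lam t) (P \<theta>) = 0" using Ann that d(3) by (auto simp: Ann_def)
    finally show ?thesis using that by (simp add: modified_lagrangian_def left_triv_inv)
  qed
  note K = this
  define m where "m s = pdiff_\<eta> G L (h s) (\<eta> s)" for s
  define \<Phi> where "\<Phi> t = pull G (h t) (pdiff_h G L (h t) (\<eta> t))
      - vector_derivative (\<lambda>s. m s - lam s) (at t within ?I) + ad_star G (\<eta> t) (m t - lam t)" for t
  have "vakonomic_extremal G t0 t1 (modified_lagrangian G L P' lam) d h \<eta> \<longleftrightarrow> (\<forall>t\<in>?I. \<Phi> t \<in> Ann UNIV)"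
    using EL[of UNIV lam "modified_lagrangian G L P' lam"] lam K assms(5,6)
    by (simp add: vakonomic_extremal_def unconstrained_extremal_def \<Phi>_def m_def[abs_def])
  also have "\<dots> \<longleftrightarrow> (\<forall>t\<in>?I. (\<forall>a\<in>d. blinfun_apply (\<Phi> t) a = 0) \<and> (\<forall>b\<in>d'. blinfun_apply (\<Phi> t) b = 0))"
  proof (intro ball_cong refl iffI)
    fix t assume *: "(\<forall>a\<in>d. blinfun_apply (\<Phi> t) a = 0) \<and> (\<forall>b\<in>d'. blinfun_apply (\<Phi> t) b = 0)"
    have "blinfun_apply (\<Phi> t) \<theta> = 0" for \<theta>
      using * d(3,4)[of \<theta>] blinfun.add_right[of "\<Phi> t" "P \<theta>" "P' \<theta>"] d(2)[of \<theta>] by simp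
    then show "\<Phi> t \<in> Ann UNIV" by (simp add: Ann_def)
  qed (simp add: Ann_def)
  (* On d the derivative of lam drops out, because lam takes values in the annihilator of d. *)
  also have "\<dots> \<longleftrightarrow> (\<forall>t\<in>?I. \<forall>a\<in>d. blinfun_apply (pull G (h t) (pdiff_h G L (h t) (\<eta> t))
          - vector_derivative m (at t within ?I) + ad_star G (\<eta> t) (m t - lam t)) a = 0) \<and>
        (\<forall>t\<in>?I. \<forall>b\<in>d'. blinfun_apply (\<Phi> t) b = 0)"
  proof -
    have "blinfun_apply (\<Phi> t) a = blinfun_apply (pull G (h t) (pdiff_h G L (h t) (\<eta> t))
          - vector_derivative m (at t within ?I) + ad_star G (\<eta> t) (m t - lam t)) a"
      if t: "t \<in> ?I" and a: "a \<in> d" for t a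
    proof -
      have "smooth_near ?I m t" unfolding m_def by (rule momentum_smooth(1)[OF assms(3) t assms(5)])
      then have "((\<lambda>s. m s - lam s) has_vector_derivative
          (vector_derivative m (at t within ?I) - vector_derivative lam (at t within ?I))) (at t within ?I)"
        using lam[OF t] by (intro has_vector_derivative_diff smooth_near_has_vector_derivative)
      then have "vector_derivative (\<lambda>s. m s - lam s) (at t within ?I)
          = vector_derivative m (at t within ?I) - vector_derivative lam (at t within ?I)"
        using assms(1) t by (intro vector_derivative_within) (auto simp: trivial_limit_within islimpt_Icc)
      moreover have "blinfun_apply (vector_derivative lam (at t within ?I)) a = 0"
        using annihilator_vector_derivative[OF assms(1) lam Ann t] a by (simp add: Ann_def)
      ultimately show ?thesis by (simp add: \<Phi>_def blinfun.add_left blinfun.diff_left)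
    qed
    then show ?thesis by auto
  qed
  finally show "vakonomic_extremal G t0 t1 (modified_lagrangian G L P' lam) d h \<eta> \<longleftrightarrow>
         (\<forall>t\<in>?I. \<forall>a\<in>d. blinfun_apply
              (pull G (h t) (pdiff_h G L (h t) (\<eta> t))
               - vector_derivative (\<lambda>s. pdiff_\<eta> G L (h s) (\<eta> s)) (at t within ?I)
               + ad_star G (\<eta> t) (pdiff_\<eta> G L (h t) (\<eta> t) - lam t)) a = 0) \<and>
         (\<forall>t\<in>?I. \<forall>b\<in>d'. blinfun_apply
              (pull G (h t) (pdiff_h G L (h t) (\<eta> t))
               - vector_derivative (\<lambda>s. pdiff_\<eta> G L (h s) (\<eta> s) - lam s) (at t within ?I)
               + ad_star G (\<eta> t) (pdiff_\<eta> G L (h t) (\<eta> t) - lam t)) b = 0)"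
    by (simp add: \<Phi>_def m_def[abs_def])
qed

end
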